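(* Let $D$ be the closed unit disk with $\omega=dx\wedge dy$, $G=\mathrm{Symp}(D)$. Let $\underline{\tau}:G\to\mathbb{R}/\mathbb{Z}$ be the composition of $\overline{\tau}/\pi^2:G\to\mathbb{R}$ with the projection $\mathbb{R}\to\mathbb{R}/\mathbb{Z}$. Then \[ \underline{\tau}+\underline{R}=\mathrm{rot}\quad\text{as maps } G\to\mathbb{R}/\mathbb{Z}, \] where $\mathrm{rot}:G\to\mathbb{R}/\mathbb{Z}$ is the pullback of Poincaré's rotation number by the restriction $G\to\mathrm{Diff}_+(S^1)$.
   Context: $G=\mathrm{Symp}(D)$ is the group of all symplectomorphisms of $D$ (not necessarily the identity on $\partial D$), $\widetilde{G}$ its universal covering group ($C^\infty$-topology), $p:\widetilde G\to G$ the projection. For a $1$-form $\eta$ with $d\eta=\omega$, $\tau_\eta(g)=\int_D g^*\eta\wedge\eta$ is a quasi-morphism and $\overline{\tau}$ its homogenization. For a path $g_t$ in $G$ with $g_0=\mathrm{id}$, let $X_t=(\partial g_t/\partial t)\circ g_t^{-1}$ and $f_{X_t}$ the unique function with $i_{X_t}\omega=df_{X_t}$, $f_{X_t}|_{\partial D}=0$; $R([g_t])=\int_0^1(\int_D f_{X_t}\omega)dt$ is a homomorphism $\widetilde G\to\mathbb{R}$. The composition of $2R/\pi^2$ with $\mathbb{R}\to\mathbb{R}/\mathbb{Z}$ factors through $p$, giving a homomorphism $\underline{R}:G\to\mathbb{R}/\mathbb{Z}$. With $S^1=\partial D=\mathbb{R}/2\pi\mathbb{Z}$, the translation number of a lift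 $\widetilde\varphi$ is $\lim_n\widetilde{\varphi}^n(0)/(2\pi n)$, and the rotation number $\mathrm{rot}:\mathrm{Diff}_+(S^1)\to\mathbb{R}/\mathbb{Z}$ is its reduction mod $\mathbb{Z}$ (independent of the lift). *)

theory Defs
  imports "HOL-Analysis.Analysis"
begin

definition Disk :: "complex set" where
  "Disk = cball 0 1"

fun Ck_on :: "nat \<Rightarrow> 'a::euclidean_space set \<Rightarrow> ('a \<Rightarrow> 'b::real_normed_vector) \<Rightarrow> bool" where
  "Ck_on 0 U f = continuous_on U f"
| "Ck_on (Suc k) U f = (continuous_on U f \<and> f differentiable_on U \<and>
      (\<forall>i\<in>Basis. Ck_on k U (\<lambda>x. frechet_derivative f (at x) i)))"

definition smooth_open :: "'a::euclidean_space set \<Rightarrow> ('a \<Rightarrow> 'b::real_normed_vector) \<Rightarrow> bool" where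
  "smooth_open U f \<longleftrightarrow> open U \<and> (\<forall>k. Ck_on k U f)"

definition smooth_on_set :: "'a::euclidean_space set \<Rightarrow> ('a \<Rightarrow> 'b::real_normed_vector) \<Rightarrow> bool" where
  "smooth_on_set S f \<longleftrightarrow> (\<exists>U f'. S \<subseteq> U \<and> smooth_open U f' \<and> (\<forall>x\<in>S. f' x = f x))"

definition jac :: "(complex \<Rightarrow> complex) \<Rightarrow> complex \<Rightarrow> real" where
  "jac g x = (let L = frechet_derivative g (at x within Disk) in Im (cnj (L 1) * L \<i>))"

definition Symp :: "(complex \<Rightarrow> complex) set" where
  "Symp = {g. bij_betw g Disk Disk \<and> smooth_on_set Disk g \<and>
              smooth_on_set Disk (inv_into Disk g) \<and> (\<forall>x\<in>Disk. jac g x = 1)}"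

text \<open>A smooth 1-form eta = a dx + b dy on D is encoded as the complex-valued
  function a + i b; its value on a vector v is eta(p) \<bullet> v.  It is a primitive of
  omega iff d eta = (b_x - a_y) dx wedge dy = omega.\<close>
definition primitive :: "(complex \<Rightarrow> complex) \<Rightarrow> bool" where
  "primitive \<eta> \<longleftrightarrow> smooth_on_set Disk \<eta> \<and>
     (\<forall>x\<in>Disk. let L = frechet_derivative \<eta> (at x within Disk) in Im (L 1) - Re (L \<i>) = 1)"

text \<open>tau_eta(g) = integral over D of g^* eta wedge eta.\<close>
definition tau :: "(complex \<Rightarrow> complex) \<Rightarrow> (complex \<Rightarrow> complex) \<Rightarrow> real" where
  "tau \<eta> g = integral Disk (\<lambda>p. let L = frechet_derivative g (at p within Disk) in
      (\<eta> (g p) \<bullet> L 1) * (\<eta> p \<bullet> \<i>) - (\<eta> (g p) \<bullet> L \<i>) * (\<eta> p \<bullet> 1))"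

definition tau_bar :: "(complex \<Rightarrow> complex) \<Rightarrow> (complex \<Rightarrow> complex) \<Rightarrow> real" where
  "tau_bar \<eta> g = lim (\<lambda>n. tau \<eta> (g ^^ n) / real n)"

definition symp_path :: "(real \<Rightarrow> complex \<Rightarrow> complex) \<Rightarrow> bool" where
  "symp_path g \<longleftrightarrow> smooth_on_set ({0..1} \<times> Disk) (\<lambda>(t,x). g t x) \<and> (\<forall>t\<in>{0..1}. g t \<in> Symp)"

definition gdot :: "(real \<Rightarrow> complex \<Rightarrow> complex) \<Rightarrow> real \<Rightarrow> complex \<Rightarrow> complex" where
  "gdot g t x = vector_derivative (\<lambda>s. g s x) (at t within {0..1})"

text \<open>H t = f_{X_t}: X_t (g_t x) = d/dt g_t x, i_{X_t} omega = d(H t), H t = 0 on the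
  boundary.  With omega = dx wedge dy, i_X omega = X1 dy - X2 dx, i.e. grad (H t) = i X_t.\<close>
definition hamiltonian_of :: "(real \<Rightarrow> complex \<Rightarrow> complex) \<Rightarrow> (real \<Rightarrow> complex \<Rightarrow> real) \<Rightarrow> bool" where
  "hamiltonian_of g H \<longleftrightarrow> (\<forall>t\<in>{0..1}.
      (\<forall>z. cmod z = 1 \<longrightarrow> H t z = 0) \<and>
      (\<forall>x\<in>Disk. (H t has_derivative (\<lambda>h. (\<i> * gdot g t x) \<bullet> h)) (at (g t x) within Disk)))"

definition R_val :: "(real \<Rightarrow> complex \<Rightarrow> real) \<Rightarrow> real" where
  "R_val H = integral {0..1} (\<lambda>t. integral Disk (H t))"

definition lift_of :: "(complex \<Rightarrow> complex) \<Rightarrow> (real \<Rightarrow> real) \<Rightarrow> bool" where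
  "lift_of g F \<longleftrightarrow> continuous_on UNIV F \<and> (\<forall>\<theta>. g (cis \<theta>) = cis (F \<theta>))"

definition transl :: "(real \<Rightarrow> real) \<Rightarrow> real" where
  "transl F = lim (\<lambda>n. (F ^^ n) 0 / (2 * pi * real n))"

end

theory Submission
  imports Defs
begin

text \<open>Write \<open>g\<^sub>t\<close> for the isotopy, \<open>X\<^sub>t\<close> for its velocity field and \<open>H\<^sub>t\<close> for its Hamiltonian. By
  Cartan's formula \<open>\<phi>\<^sup>*\<eta> - \<eta> = dK\<close> with the action \<open>K(x) = \<integral> (H\<^sub>t + \<eta>(X\<^sub>t))(g\<^sub>t x) dt\<close>, hence
  \<open>(\<phi>\<^sup>n)\<^sup>*\<eta> - \<eta> = dK\<^sub>n\<close> with \<open>K\<^sub>n = \<Sum>i<n. K \<circ> \<phi>\<^sup>i\<close>, and Green's theorem together with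
  invariance of area gives \<open>\<tau>(\<phi>\<^sup>n) = \<integral>\<^bsub>\<partial>D\<^esub> K\<^sub>n \<eta> - n \<integral>\<^bsub>D\<^esub> K\<close>. Green's theorem for
  \<open>H\<^sub>t \<eta>\<close>, where \<open>H\<^sub>t\<close> vanishes on the circle, shows \<open>\<integral>\<^bsub>D\<^esub> \<eta>(X\<^sub>t) = \<integral>\<^bsub>D\<^esub> H\<^sub>t\<close>, so
  \<open>\<integral>\<^bsub>D\<^esub> K = 2 R\<close>. On the circle \<open>K(cis \<theta>) = A(F \<theta>) - A(\<theta>)\<close>, where \<open>F\<close> is the lift of \<open>\<phi>\<close>
  given by the isotopy and \<open>A\<close> is a primitive of \<open>\<eta>\<close> along the circle; since \<open>\<eta>\<close> has integral
  \<open>\<pi>\<close> over the circle, \<open>A(\<theta>) - \<theta>/2\<close> is periodic. Thus \<open>K\<^sub>n\<close> telescopes to \<open>F\<^sup>n(0)/2\<close> up to a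
  bounded error, \<open>\<tau>(\<phi>\<^sup>n) + 2nR = \<pi> F\<^sup>n(0)/2 + O(1)\<close>, and dividing by \<open>n\<close> gives the
  theorem.\<close>

section \<open>Integration over the disk\<close>

text \<open>Fubini and the image measure rule belong to Lebesgue integration, whereas
  \<open>tau\<close> and \<open>R_val\<close> are gauge integrals. For a continuous function on a
  compact set, extended by zero, the two agree.\<close>

lemma integrable_compact_indicator:
  fixes f :: "'a::euclidean_space \<Rightarrow> 'b::euclidean_space"
  assumes "compact C" "continuous_on C f"
  shows "integrable lborel (\<lambda>x. indicator C x *\<^sub>R f x)"
    and "integral C f = (LBINT x. indicator C x *\<^sub>R f x)"
proof -
  show "integrable lborel (\<lambda>x. indicator C x *\<^sub>R f x)"
    using borel_integrable_compact[OF assms] by simp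
  then have "set_integrable lborel C f"
    by (simp add: set_integrable_def)
  from set_borel_integral_eq_integral(2)[OF this]
  show "integral C f = (LBINT x. indicator C x *\<^sub>R f x)"
    by (simp add: set_lebesgue_integral_def)
qed

text \<open>Fubini for the extension of \<open>f\<close> by zero. Slices of a compact set are
  compact, so every inner Lebesgue integral is again a gauge integral.\<close>

lemma integral_compact_slices:
  fixes f :: "'a::euclidean_space \<times> 'b::euclidean_space \<Rightarrow> 'c::euclidean_space"
  assumes C: "compact C" and f: "continuous_on C f"
  shows "integral C f = integral UNIV (\<lambda>x. integral {y. (x, y) \<in> C} (\<lambda>y. f (x, y)))" (is ?fst)
    and "integral C f = integral UNIV (\<lambda>y. integral {x. (x, y) \<in> C} (\<lambda>x. f (x, y)))" (is ?snd)
proof -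
  let ?F = "\<lambda>x y. indicator C (x, y) *\<^sub>R f (x, y)"
  have int: "integrable (lborel \<Otimes>\<^sub>M lborel) (\<lambda>(x, y). ?F x y)"
    using integrable_compact_indicator(1)[OF assms] by (simp add: lborel_prod case_prod_beta')
  have eq: "integral C f = integral\<^sup>L (lborel \<Otimes>\<^sub>M lborel) (\<lambda>(x, y). ?F x y)"
    using integrable_compact_indicator(2)[OF assms] by (simp add: lborel_prod case_prod_beta')
  have sl1: "integral {y. (x, y) \<in> C} (\<lambda>y. f (x, y)) = (LBINT y. ?F x y)" for x
  proof -
    have "compact (snd ` (C \<inter> ({x} \<times> UNIV)))"
      by (intro compact_continuous_image compact_Int_closed C closed_Times) (auto intro: continuous_intros)
    moreover have "snd ` (C \<inter> ({x} \<times> UNIV)) = {y. (x, y) \<in> C}" by force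
    ultimately have "compact {y. (x, y) \<in> C}" by simp
    moreover have "continuous_on {y. (x, y) \<in> C} (\<lambda>y. f (x, y))"
      by (rule continuous_on_compose2[OF f]) (auto intro!: continuous_intros)
    ultimately show ?thesis
      by (subst integrable_compact_indicator(2)) (auto simp: indicator_def)
  qed
  have sl2: "integral {x. (x, y) \<in> C} (\<lambda>x. f (x, y)) = (LBINT x. ?F x y)" for y
  proof -
    have "compact (fst ` (C \<inter> (UNIV \<times> {y})))"
      by (intro compact_continuous_image compact_Int_closed C closed_Times) (auto intro: continuous_intros)
    moreover have "fst ` (C \<inter> (UNIV \<times> {y})) = {x. (x, y) \<in> C}" by force
    ultimately have "compact {x. (x, y) \<in> C}" by simp
    moreover have "continuous_on {x. (x, y) \<in> C} (\<lambda>x. f (x, y))"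
      by (rule continuous_on_compose2[OF f]) (auto intro!: continuous_intros)
    ultimately show ?thesis
      by (subst integrable_compact_indicator(2)) (auto simp: indicator_def)
  qed
  show ?fst
    unfolding sl1 eq
    by (subst integral_lborel[OF lborel_pair.integrable_fst[OF int]]) (rule lborel_pair.integral_fst[OF int, symmetric])
  show ?snd
    unfolding sl2 eq
    by (subst integral_lborel[OF lborel_pair.integrable_snd[OF int]]) (rule lborel_pair.integral_snd[OF int, symmetric])
qed

lemma integral_swap_compact:
  fixes f :: "'a::euclidean_space \<times> 'b::euclidean_space \<Rightarrow> 'c::euclidean_space"
  assumes S: "compact S" and T: "compact T" and f: "continuous_on (S \<times> T) f"
  shows "integral S (\<lambda>x. integral T (\<lambda>y. f (x, y))) = integral T (\<lambda>y. integral S (\<lambda>x. f (x, y)))"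
proof -
  note sl = integral_compact_slices[OF compact_Times[OF S T] f]
  have 1: "(\<lambda>x. integral {y. (x, y) \<in> S \<times> T} (\<lambda>y. f (x, y))) = (\<lambda>x. if x \<in> S then integral T (\<lambda>y. f (x, y)) else 0)"
    by (auto simp: fun_eq_iff)
  have 2: "(\<lambda>y. integral {x. (x, y) \<in> S \<times> T} (\<lambda>x. f (x, y))) = (\<lambda>y. if y \<in> T then integral S (\<lambda>x. f (x, y)) else 0)"
    by (auto simp: fun_eq_iff)
  show ?thesis using sl unfolding 1 2 integral_restrict_UNIV by simp
qed

section \<open>Lebesgue measure on the complex plane and slices of the disk\<close>

lemma lborel_complex_prod: "distr lborel borel (\<lambda>p. Complex (snd p) (fst p)) = lborel"
proof (rule lborel_eqI[symmetric])
  fix l u :: complex assume le: "\<And>b. b \<in> Basis \<Longrightarrow> l \<bullet> b \<le> u \<bullet> b"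
  have lu: "Re l \<le> Re u" "Im l \<le> Im u"
    using le[of 1] le[of \<i>] by (simp_all add: Basis_complex_def)
  have c: "continuous_on UNIV (\<lambda>p::real \<times> real. Complex (snd p) (fst p))"
    unfolding Complex_eq by (intro continuous_intros)
  have "(\<lambda>p. Complex (snd p) (fst p)) -` box l u = box (Im l, Re l) (Im u, Re u)"
    by (auto simp: box_def Basis_complex_def Basis_prod_def)
  moreover have "emeasure lborel (box (Im l, Re l) (Im u, Re u)) = (\<Prod>b\<in>Basis. ((Im u, Re u) - (Im l, Re l)) \<bullet> b)"
    by (rule emeasure_lborel_box) (use lu in \<open>auto simp: Basis_prod_def\<close>)
  moreover have "(\<Prod>b\<in>Basis. ((Im u, Re u) - (Im l, Re l)) \<bullet> b) = (\<Prod>b\<in>Basis. (u - l) \<bullet> b)"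
    by (simp add: Basis_prod_def Basis_complex_def)
  ultimately show "emeasure (distr lborel borel (\<lambda>p. Complex (snd p) (fst p))) (box l u) = (\<Prod>b\<in>Basis. (u - l) \<bullet> b)"
    using borel_measurable_continuous_onI[OF c] by (simp add: emeasure_distr)
qed simp

text \<open>The image measure rule for a coordinate change \<open>c\<close> that carries Lebesgue
  measure to itself. It serves both real models of the plane, pairs of reals and
  \<open>real^2\<close>.\<close>

lemma integral_lborel_iso:
  fixes f :: "'b::euclidean_space \<Rightarrow> 'c::euclidean_space" and c :: "'a::euclidean_space \<Rightarrow> 'b"
  assumes dist: "distr lborel borel c = lborel" and c: "continuous_on UNIV c"
    and C: "compact C" and C': "compact (c -` C)" and f: "continuous_on C f"
  shows "integral C f = integral (c -` C) (\<lambda>x. f (c x))"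
proof -
  have f': "continuous_on (c -` C) (\<lambda>x. f (c x))"
    by (rule continuous_on_compose2[OF f continuous_on_subset[OF c]]) auto
  have "integral C f = (\<integral>z. indicator C z *\<^sub>R f z \<partial>distr lborel borel c)"
    using integrable_compact_indicator(2)[OF C f] by (simp add: dist)
  also have "\<dots> = (LBINT x. indicator (c -` C) x *\<^sub>R f (c x))"
  proof (subst integral_distr)
    show "c \<in> lborel \<rightarrow>\<^sub>M borel" using borel_measurable_continuous_onI[OF c] by simp
    show "(\<lambda>z. indicator C z *\<^sub>R f z) \<in> borel_measurable borel"
      using borel_measurable_integrable[OF integrable_compact_indicator(1)[OF C f]] by simp
  qed (auto simp: indicator_def)
  also have "\<dots> = integral (c -` C) (\<lambda>x. f (c x))"
    by (rule integrable_compact_indicator(2)[OF C' f', symmetric])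
  finally show ?thesis .
qed

text \<open>In the product model the first coordinate is the imaginary part, so the outer variable
  is \<open>y\<close> and the slices are horizontal.\<close>

lemma integral_complex_slices:
  fixes f :: "complex \<Rightarrow> real"
  assumes C: "compact C" and f: "continuous_on C f"
  shows "integral C f = integral UNIV (\<lambda>y. integral {x. Complex x y \<in> C} (\<lambda>x. f (Complex x y)))"
proof -
  let ?c = "\<lambda>p::real \<times> real. Complex (snd p) (fst p)"
  have c: "continuous_on S ?c" for S
    unfolding Complex_eq by (intro continuous_intros)
  have "?c -` C = (\<lambda>z. (Im z, Re z)) ` C" by (force simp: image_iff)
  then have C': "compact (?c -` C)" by (auto intro!: compact_continuous_image C continuous_intros)
  have f': "continuous_on (?c -` C) (\<lambda>p. f (?c p))"
    by (rule continuous_on_compose2[OF f c]) auto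
  show ?thesis
    by (subst integral_lborel_iso[OF lborel_complex_prod c C C' f], subst integral_compact_slices(1)[OF C' f']) simp
qed

lemma compact_Disk[simp]: "compact Disk"
  by (simp add: Disk_def)

lemma Disk_iff: "z \<in> Disk \<longleftrightarrow> cmod z \<le> 1"
  by (simp add: Disk_def)

lemma integral_Disk_slices:
  fixes f :: "complex \<Rightarrow> real"
  assumes f: "continuous_on Disk f"
  shows "integral Disk f = integral {-1..1} (\<lambda>y. integral {-sqrt (1-y\<^sup>2)..sqrt (1-y\<^sup>2)} (\<lambda>x. f (Complex x y)))"
proof -
  have sl: "{x. Complex x y \<in> Disk} = (if y \<in> {-1..1} then {-sqrt (1-y\<^sup>2)..sqrt (1-y\<^sup>2)} else {})" for y
  proof (cases "y \<in> {-1..1}")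
    case True
    then have "y\<^sup>2 \<le> 1" by (auto simp: abs_square_le_1 abs_le_iff)
    have "Complex x y \<in> Disk \<longleftrightarrow> x \<in> {-sqrt (1-y\<^sup>2)..sqrt (1-y\<^sup>2)}" for x
    proof -
      have "x \<in> {-sqrt (1-y\<^sup>2)..sqrt (1-y\<^sup>2)} \<longleftrightarrow> \<bar>x\<bar> \<le> sqrt (1-y\<^sup>2)"
        by (simp only: atLeastAtMost_iff) linarith
      also have "\<dots> \<longleftrightarrow> sqrt (x\<^sup>2) \<le> sqrt (1-y\<^sup>2)" by simp
      also have "\<dots> \<longleftrightarrow> x\<^sup>2 + y\<^sup>2 \<le> 1" by (simp only: real_sqrt_le_iff) linarith
      finally show ?thesis by (simp add: Disk_iff cmod_def)
    qed
    then show ?thesis using True by (simp add: set_eq_iff)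
  next
    case False
    then have "\<not> y\<^sup>2 \<le> 1" by (auto simp: abs_square_le_1 abs_le_iff)
    then have "\<not> x\<^sup>2 + y\<^sup>2 \<le> 1" for x using zero_le_power2[of x] by linarith
    then have "Complex x y \<notin> Disk" for x by (simp add: Disk_iff cmod_def)
    with False show ?thesis by auto
  qed
  have "(\<lambda>y. integral {x. Complex x y \<in> Disk} (\<lambda>x. f (Complex x y))) =
     (\<lambda>y. if y \<in> {-1..1} then integral {-sqrt (1-y\<^sup>2)..sqrt (1-y\<^sup>2)} (\<lambda>x. f (Complex x y)) else 0)"
    unfolding sl by auto
  then show ?thesis
    by (subst integral_complex_slices[OF compact_Disk f]) (simp only: integral_restrict_UNIV)
qed

section \<open>Green's theorem and area-preserving maps\<close>

text \<open>A real-linear map is stored by its values at 1 and \<i>, so that partial derivatives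
  become functions whose continuity and integrals can be discussed.\<close>

definition lin2 :: "'b::real_vector \<Rightarrow> 'b \<Rightarrow> complex \<Rightarrow> 'b" where
  "lin2 a b h = Re h *\<^sub>R a + Im h *\<^sub>R b"

text \<open>Derivatives are demanded only in the open disk, where \<open>at x\<close> and
  \<open>at x within Disk\<close> agree. On the circle \<open>u1\<close> and \<open>u2\<close> are
  just the continuous extensions of the partial derivatives, which is enough for Green's
  theorem.\<close>

definition C1_disk :: "(complex \<Rightarrow> 'b::real_normed_vector) \<Rightarrow> (complex \<Rightarrow> 'b) \<Rightarrow> (complex \<Rightarrow> 'b) \<Rightarrow> bool" where
  "C1_disk u u1 u2 \<longleftrightarrow> continuous_on Disk u \<and> continuous_on Disk u1 \<and> continuous_on Disk u2 \<and>
     (\<forall>x\<in>ball 0 1. (u has_derivative lin2 (u1 x) (u2 x)) (at x))"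

lemma lin2_simps[simp]: "lin2 a b 1 = a" "lin2 a b \<i> = b"
  by (simp_all add: lin2_def)

lemma linear_eq_lin2: "linear L \<Longrightarrow> L = lin2 (L 1) (L \<i>)"
proof
  fix h assume "linear L"
  have "h = Re h *\<^sub>R 1 + Im h *\<^sub>R \<i>" by (simp add: complex_eq_iff)
  then have "L h = L (Re h *\<^sub>R 1 + Im h *\<^sub>R \<i>)" by simp
  also have "\<dots> = lin2 (L 1) (L \<i>) h"
    using \<open>linear L\<close> by (simp add: linear_add linear_scale lin2_def)
  finally show "L h = lin2 (L 1) (L \<i>) h" .
qed

lemma has_derivative_lin2_cong:
  assumes "(f has_derivative L) F" "L 1 = a" "L \<i> = b"
  shows "(f has_derivative lin2 a b) F"
  using assms linear_eq_lin2[OF has_derivative_linear[OF assms(1)]] by simp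

lemma integral_periodic_shift:
  fixes f :: "real \<Rightarrow> real"
  assumes f: "continuous_on UNIV f" and per: "\<And>x. f (x + p) = f x" and ab: "a \<le> b" "b \<le> a + p"
  shows "integral {a..a+p} f = integral {b..b+p} f"
proof -
  have i: "f integrable_on {x..y}" for x y
    by (intro integrable_continuous_real continuous_on_subset[OF f]) auto
  have "integral {a..a+p} f = integral {a..b} f + integral {b..a+p} f"
    using ab by (intro Henstock_Kurzweil_Integration.integral_combine[symmetric] i) auto
  moreover have "integral {b..b+p} f = integral {b..a+p} f + integral {a+p..b+p} f"
    using ab by (intro Henstock_Kurzweil_Integration.integral_combine[symmetric] i) auto
  moreover have "integral {a..b} (f \<circ> (\<lambda>x. x + p)) = integral {a+p..b+p} f"
    by (rule integral_shift) (intro continuous_on_subset[OF f], auto)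
  ultimately show ?thesis by (simp add: o_def per)
qed

text \<open>On each horizontal chord the fundamental theorem of calculus leaves \<open>Q\<close> at
  the right end minus \<open>Q\<close> at the left end. Substituting \<open>y = sin \<theta>\<close>
  turns the right ends into the right half circle and the left ends into the left half
  circle.\<close>

lemma Disk_integral_deriv_x:
  fixes Q :: "complex \<Rightarrow> real"
  assumes "C1_disk Q q q'"
  shows "integral Disk q = integral {0..2*pi} (\<lambda>\<theta>. Q (cis \<theta>) * cos \<theta>)"
proof -
  have Q: "continuous_on Disk Q" and q: "continuous_on Disk q"
    and D: "\<And>x. x \<in> ball 0 1 \<Longrightarrow> (Q has_derivative lin2 (q x) (q' x)) (at x)"
    using assms by (auto simp: C1_disk_def)
  define r where "r y = sqrt (1 - y\<^sup>2)" for y :: real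
  define d where "d y = Q (Complex (r y) y) - Q (Complex (- r y) y)" for y
  have sq: "y\<^sup>2 \<le> 1" if "y \<in> {-1..1}" for y :: real
    using that by (auto simp: abs_square_le_1 abs_le_iff)
  have r2: "(r y)\<^sup>2 = 1 - y\<^sup>2" if "y \<in> {-1..1}" for y
    using sq[OF that] by (simp add: r_def)
  have "integral {- r y..r y} (\<lambda>x. q (Complex x y)) = d y" if y: "y \<in> {-1..1}" for y
  \<comment> \<open>The interior version applies because the ends of the chord lie on the circle,
    where only continuity of \<open>Q\<close> is known.\<close>
  proof (rule integral_unique, unfold d_def, rule fundamental_theorem_of_calculus_interior)
    show "- r y \<le> r y" using sq[OF y] by (simp add: r_def)
    have ins: "Complex x y \<in> Disk" if "x \<in> {- r y..r y}" for x
    proof -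
      have "\<bar>x\<bar> \<le> r y" using that by auto
      then have "x\<^sup>2 \<le> (r y)\<^sup>2" by (metis abs_ge_zero power2_abs power_mono)
      then show ?thesis using r2[OF y] by (simp add: Disk_iff cmod_def)
    qed
    show "continuous_on {- r y..r y} (\<lambda>x. Q (Complex x y))"
      by (rule continuous_on_compose2[OF Q]) (use ins in \<open>auto simp: Complex_eq intro!: continuous_intros\<close>)
    fix x assume x: "x \<in> {- r y<..<r y}"
    then have "\<bar>x\<bar> < r y" by auto
    then have "x\<^sup>2 < (r y)\<^sup>2" by (metis abs_ge_zero power2_abs power_strict_mono zero_less_numeral)
    then have "x\<^sup>2 + y\<^sup>2 < 1" using r2[OF y] by simp
    then have "Complex x y \<in> ball 0 1"
      by (simp add: cmod_def)
    note D = D[OF this]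
    have "((\<lambda>x. Complex x y) has_vector_derivative 1) (at x)"
      unfolding Complex_eq has_vector_derivative_def by (auto intro!: derivative_eq_intros simp: scaleR_conv_of_real)
    from vector_derivative_diff_chain_within[OF this has_derivative_at_withinI[OF D]]
    show "((\<lambda>x. Q (Complex x y)) has_vector_derivative q (Complex x y)) (at x)"
      by (simp add: o_def)
  qed
  then have "integral Disk q = integral {-1..1} d"
    unfolding integral_Disk_slices[OF q] by (intro integral_cong) (auto simp: r_def)
  also have "\<dots> = integral {sin (-(pi/2))..sin (pi/2)} d" by simp
  also have "\<dots> = integral {-(pi/2)..pi/2} (\<lambda>\<theta>. cos \<theta> *\<^sub>R d (sin \<theta>))"
  proof (rule integral_unique[symmetric], rule has_integral_substitution)
    have 1: "continuous_on {-1..1} (\<lambda>y. Complex (r y) y)" "continuous_on {-1..1} (\<lambda>y. Complex (- r y) y)"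
      unfolding Complex_eq r_def by (auto intro!: continuous_intros)
    show "continuous_on {-1..1} d" unfolding d_def
      by (intro continuous_on_diff continuous_on_compose2[OF Q 1(1)] continuous_on_compose2[OF Q 1(2)])
        (auto simp: Disk_iff cmod_def r2)
  qed (auto intro!: derivative_eq_intros)
  \<comment> \<open>The left end of the chord at height \<open>sin \<theta>\<close> is
    \<open>cis (pi - \<theta>)\<close>, whose cosine is \<open>- cos \<theta>\<close>; this absorbs
    the minus sign in \<open>d\<close>.\<close>
  also have "\<dots> = integral {-(pi/2)..pi/2} (\<lambda>\<theta>. Q (cis \<theta>) * cos \<theta> + Q (cis (- \<theta> + pi)) * cos (- \<theta> + pi))"
  proof (rule integral_cong)
    fix \<theta> assume "\<theta> \<in> {-(pi/2)..pi/2}"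
    then have "0 \<le> cos \<theta>" by (intro cos_ge_zero) auto
    then have "r (sin \<theta>) = cos \<theta>"
      by (simp add: r_def cos_squared_eq[symmetric])
    then have "Complex (r (sin \<theta>)) (sin \<theta>) = cis \<theta>" "Complex (- r (sin \<theta>)) (sin \<theta>) = cis (- \<theta> + pi)"
      by (simp_all add: complex_eq_iff)
    then show "cos \<theta> *\<^sub>R d (sin \<theta>) = Q (cis \<theta>) * cos \<theta> + Q (cis (- \<theta> + pi)) * cos (- \<theta> + pi)"
      by (simp add: d_def algebra_simps)
  qed
  also have "\<dots> = integral {0..2*pi} (\<lambda>\<theta>. Q (cis \<theta>) * cos \<theta>)"
  proof -
    let ?f = "\<lambda>\<theta>. Q (cis \<theta>) * cos \<theta>"
    have cis_per: "cis (x + 2*pi) = cis x" for x by (simp add: complex_eq_iff)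
    have cf: "continuous_on S ?f" for S
      by (intro continuous_intros continuous_on_compose2[OF Q]) (auto simp: Disk_iff)
    have ig: "?f integrable_on {x..y}" for x y
      by (intro integrable_continuous_real cf)
    have cg: "continuous_on S (\<lambda>\<theta>. ?f (- \<theta> + pi))" for S
      by (rule continuous_on_compose2[OF cf[of UNIV]]) (auto intro!: continuous_intros)
    \<comment> \<open>The substitution \<open>\<theta> \<mapsto> pi - \<theta>\<close> is a
      reflection followed by a shift by \<open>pi\<close>; the bound \<open>-(-(pi/2))\<close> is
      the form in the reflection rule.\<close>
    have "integral {-(pi/2)..-(-(pi/2))} (\<lambda>\<theta>. ?f (- \<theta> + pi)) = integral {-(pi/2)..pi/2} (\<lambda>\<theta>. ?f (\<theta> + pi))"
      by (rule Henstock_Kurzweil_Integration.integral_reflect_real[where f = "\<lambda>\<theta>. ?f (\<theta> + pi)"])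
    also have "\<dots> = integral {-(pi/2)+pi..pi/2+pi} ?f"
      using integral_shift[OF cf, of "-(pi/2)" "pi/2" pi] by (simp add: o_def)
    also have "{-(pi/2)+pi..pi/2+pi} = {pi/2..pi/2+pi}" by simp
    finally have reflect: "integral {-(pi/2)..pi/2} (\<lambda>\<theta>. ?f (- \<theta> + pi)) = integral {pi/2..pi/2+pi} ?f"
      by (simp only: minus_minus)
    have "integral {-(pi/2)..pi/2} (\<lambda>\<theta>. ?f \<theta> + ?f (- \<theta> + pi)) =
      integral {-(pi/2)..pi/2} ?f + integral {-(pi/2)..pi/2} (\<lambda>\<theta>. ?f (- \<theta> + pi))"
      by (intro Henstock_Kurzweil_Integration.integral_add integrable_continuous_real cg cf)
    also have "\<dots> = integral {-(pi/2)..pi/2} ?f + integral {pi/2..pi/2+pi} ?f"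
      by (simp only: reflect)
    also have "\<dots> = integral {-(pi/2)..pi/2+pi} ?f"
      by (intro Henstock_Kurzweil_Integration.integral_combine ig) auto
    also have "{-(pi/2)..pi/2+pi} = {-(pi/2)..-(pi/2) + 2*pi}" by simp
    also have "integral \<dots> ?f = integral {0..0 + 2*pi} ?f"
      by (rule integral_periodic_shift) (simp_all add: cf cis_per)
    finally show ?thesis by simp
  qed
  finally show ?thesis .
qed

section \<open>Change of variables for area-preserving maps of the disk\<close>

lemma integral_ball_cball:
  fixes f :: "'a::euclidean_space \<Rightarrow> 'b::euclidean_space"
  shows "integral (ball a r) f = integral (cball a r) f"
  by (rule integral_spike_set; rule negligible_subset[OF negligible_sphere[of a r]]) (auto simp: less_le)

text \<open>The change of variables theorem is stated for \<open>real^n\<close>; this linear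
  isometry transports it to the complex plane.\<close>

definition vec2_complex :: "real^2 \<Rightarrow> complex" where
  "vec2_complex v = Complex (v$1) (v$2)"

definition complex_vec2 :: "complex \<Rightarrow> real^2" where
  "complex_vec2 z = (\<chi> i. if i = 1 then Re z else Im z)"

lemma vec2_complex_inverse[simp]: "complex_vec2 (vec2_complex v) = v" "vec2_complex (complex_vec2 z) = z"
  by (auto simp: vec2_complex_def complex_vec2_def vec_eq_iff forall_2)

lemma norm_vec2_complex[simp]: "norm (vec2_complex v) = norm v"
  by (simp add: vec2_complex_def norm_vec_def L2_set_def sum_2 cmod_def)

lemma norm_complex_vec2[simp]: "norm (complex_vec2 z) = norm z"
  using norm_vec2_complex[of "complex_vec2 z"] by simp

lemma linear_vec2_complex: "linear vec2_complex" and linear_complex_vec2: "linear complex_vec2"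
  by (auto intro!: linearI simp: vec2_complex_def complex_vec2_def vec_eq_iff complex_eq_iff)

lemmas bounded_linear_vec2 = linear_conv_bounded_linear[THEN iffD1, OF linear_vec2_complex]
  linear_conv_bounded_linear[THEN iffD1, OF linear_complex_vec2]

lemma lborel_vec2_complex: "distr lborel borel vec2_complex = lborel"
proof (rule lborel_eqI[symmetric])
  fix l u :: complex assume le: "\<And>b. b \<in> Basis \<Longrightarrow> l \<bullet> b \<le> u \<bullet> b"
  have lu: "Re l \<le> Re u" "Im l \<le> Im u"
    using le[of 1] le[of \<i>] by (simp_all add: Basis_complex_def)
  have B: "Basis = {axis 1 1, axis 2 1 :: real^2}"
    by (auto simp: Basis_vec_def UNIV_2)
  have "vec2_complex -` box l u = box (complex_vec2 l) (complex_vec2 u)"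
    by (auto simp: box_def Basis_complex_def B inner_axis vec2_complex_def complex_vec2_def)
  moreover have "emeasure lborel (box (complex_vec2 l) (complex_vec2 u)) = (\<Prod>b\<in>Basis. (complex_vec2 u - complex_vec2 l) \<bullet> b)"
    by (rule emeasure_lborel_box) (use lu in \<open>auto simp: B inner_axis complex_vec2_def\<close>)
  moreover have "(\<Prod>b\<in>Basis. (complex_vec2 u - complex_vec2 l) \<bullet> b) = (\<Prod>b\<in>Basis. (u - l) \<bullet> b)"
    by (simp add: B inner_axis complex_vec2_def Basis_complex_def axis_eq_axis)
  ultimately show "emeasure (distr lborel borel vec2_complex) (box l u) = (\<Prod>b\<in>Basis. (u - l) \<bullet> b)"
    using borel_measurable_continuous_onI[OF linear_continuous_on[OF bounded_linear_vec2(1)]] by (simp add: emeasure_distr)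
qed simp

lemma integral_Disk_vec2:
  fixes f :: "complex \<Rightarrow> real"
  assumes f: "continuous_on Disk f"
  shows "integral Disk f = integral (ball 0 1) (\<lambda>v. f (vec2_complex v))"
proof -
  have "vec2_complex -` Disk = cball 0 1" by (auto simp: Disk_iff)
  then show ?thesis
    using integral_lborel_iso[OF lborel_vec2_complex linear_continuous_on[OF bounded_linear_vec2(1)] compact_Disk _ f]
    by (simp add: integral_ball_cball)
qed

text \<open>\<open>Im (cnj a * b)\<close> is the signed area spanned by \<open>a\<close> and
  \<open>b\<close>, the expression used in \<open>jac\<close>. So the condition in
  \<open>Symp\<close> says that the Jacobian determinant is 1.\<close>

lemma det_lin2_vec2:
  "det (matrix (\<lambda>v. complex_vec2 (lin2 a b (vec2_complex v)))) = Im (cnj a * b)"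
  by (simp add: det_2 matrix_def lin2_def complex_vec2_def vec2_complex_def axis_def)

text \<open>The change of variables takes place on the open disk, where \<open>g\<close> is
  differentiable and bijective with determinant 1. The circle has measure zero, and continuity of
  \<open>u\<close> on \<open>Disk\<close> provides integrability.\<close>

lemma integral_Disk_area_preserving:
  fixes u :: "complex \<Rightarrow> real"
  assumes g: "C1_disk g g1 g2" and bij: "bij_betw g (ball 0 1) (ball 0 1)" and im: "g ` Disk \<subseteq> Disk"
    and J: "\<And>x. x \<in> ball 0 1 \<Longrightarrow> Im (cnj (g1 x) * g2 x) = 1"
    and u: "continuous_on Disk u"
  shows "integral Disk (\<lambda>x. u (g x)) = integral Disk u"
proof -
  let ?S = "ball 0 1 :: (real^2) set"
  \<comment> \<open>Scalar values are wrapped in \<open>real^1\<close> to fit the codomain in the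
    change of variables theorem.\<close>
  let ?F = "\<lambda>v. vec (u (vec2_complex v)) :: real^1"
  let ?g = "\<lambda>v. complex_vec2 (g (vec2_complex v))"
  let ?g' = "\<lambda>v w. complex_vec2 (lin2 (g1 (vec2_complex v)) (g2 (vec2_complex v)) (vec2_complex w))"
  have c: "continuous_on S vec2_complex" for S
    by (rule linear_continuous_on[OF bounded_linear_vec2(1)])
  have gc: "continuous_on Disk g" using g by (simp add: C1_disk_def)
  have ball: "vec2_complex v \<in> ball 0 1 \<longleftrightarrow> v \<in> ?S" for v by simp
  have der: "(?g has_derivative ?g' v) (at v within ?S)" if "v \<in> ?S" for v
  proof -
    have gd: "(g has_derivative lin2 (g1 (vec2_complex v)) (g2 (vec2_complex v))) (at (vec2_complex v))"
      using g that unfolding C1_disk_def ball[symmetric] by blast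
    have "(?g has_derivative ?g' v) (at v)"
      by (intro bounded_linear.has_derivative[OF bounded_linear_vec2(2)]
          has_derivative_compose[OF bounded_linear_imp_has_derivative[OF bounded_linear_vec2(1)] gd])
    then show ?thesis by (rule has_derivative_at_withinI)
  qed
  have inj: "inj_on ?g ?S"
  proof (rule inj_onI)
    fix v w assume vw: "v \<in> ?S" "w \<in> ?S" "?g v = ?g w"
    then have "g (vec2_complex v) = g (vec2_complex w)" by (metis vec2_complex_inverse(2))
    then have "vec2_complex v = vec2_complex w"
      using bij vw unfolding bij_betw_def inj_on_def ball[symmetric] by blast
    then show "v = w" by (metis vec2_complex_inverse(1))
  qed
  have img: "?g ` ?S = ?S"
  proof -
    have "?g ` ?S = complex_vec2 ` g ` vec2_complex ` ?S" by (simp add: image_image)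
    also have "vec2_complex ` ?S = ball 0 1"
      by (auto intro: image_eqI[where x = "complex_vec2 z" for z])
    also have "g ` ball 0 1 = ball 0 1" using bij by (simp add: bij_betw_def)
    also have "complex_vec2 ` ball 0 1 = ?S"
      by (auto intro: image_eqI[where x = "vec2_complex z" for z])
    finally show ?thesis .
  qed
  have Fc: "continuous_on (cball 0 1) ?F"
    unfolding vec_def by (intro continuous_on_vec_lambda continuous_on_compose2[OF u c]) (auto simp: Disk_iff)
  have "set_integrable lebesgue (cball 0 1) ?F"
    unfolding set_integrable_def using integrable_compact_indicator(1)[OF compact_cball Fc]
    by (subst integrable_completion) (auto dest: borel_measurable_integrable)
  then have Fi: "?F absolutely_integrable_on ?S"
    by (rule set_integrable_subset) auto
  have "integral (?g ` ?S) ?F = integral ?S (\<lambda>v. \<bar>det (matrix (?g' v))\<bar> *\<^sub>R ?F (?g v))"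
    by (rule integral_change_of_variables[OF _ der inj]) (use Fi img in auto)
  also have "\<dots> = integral ?S (\<lambda>v. ?F (?g v))"
    by (rule integral_cong) (simp only: det_lin2_vec2 J ball abs_one scaleR_one)
  finally have "integral ?S ?F = integral ?S (\<lambda>v. ?F (?g v))" by (simp only: img)
  then have "integral ?S (\<lambda>v. u (vec2_complex v)) = integral ?S (\<lambda>v. u (g (vec2_complex v)))"
    by (simp add: integral_on_1_eq vec_eq_iff)
  moreover have "continuous_on Disk (\<lambda>x. u (g x))"
    by (rule continuous_on_compose2[OF u gc im])
  ultimately show ?thesis
    by (simp add: integral_Disk_vec2 u)
qed

text \<open>The quarter turn \<open>z \<mapsto> \<i> * z\<close> preserves area and makes
  \<open>q\<close> an x-derivative, that of \<open>Q (\<i> * z)\<close>, so that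
  \<open>Disk_integral_deriv_x\<close> applies. Shifting the angle by \<open>pi/2\<close> then turns
  the cosine into a sine.\<close>

lemma Disk_integral_deriv_y:
  fixes Q :: "complex \<Rightarrow> real"
  assumes "C1_disk Q q' q"
  shows "integral Disk q = integral {0..2*pi} (\<lambda>\<theta>. Q (cis \<theta>) * sin \<theta>)"
proof -
  have Q: "continuous_on Disk Q" and q: "continuous_on Disk q" and q': "continuous_on Disk q'"
    and D: "\<And>x. x \<in> ball 0 1 \<Longrightarrow> (Q has_derivative lin2 (q' x) (q x)) (at x)"
    using assms by (auto simp: C1_disk_def)
  have rot: "continuous_on Disk (\<lambda>z. \<i> * z)" "(\<lambda>z. \<i> * z) ` Disk \<subseteq> Disk"
    by (auto intro!: continuous_intros simp: Disk_iff norm_mult)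
  have "integral Disk q = integral Disk (\<lambda>z. q (\<i> * z))"
  proof (rule integral_Disk_area_preserving[symmetric, where ?g1.0 = "\<lambda>_. \<i>" and ?g2.0 = "\<lambda>_. -1"])
    show "C1_disk (\<lambda>z. \<i> * z) (\<lambda>_. \<i>) (\<lambda>_. - 1)"
      unfolding C1_disk_def
    proof (intro conjI ballI rot continuous_intros)
      show "((\<lambda>z. \<i> * z) has_derivative lin2 \<i> (-1)) (at x)" for x
        by (rule has_derivative_lin2_cong[where L = "\<lambda>h. \<i> * h"]) (auto intro!: derivative_eq_intros)
    qed
    show "bij_betw (\<lambda>z. \<i> * z) (ball 0 1) (ball 0 1)"
      by (rule bij_betw_byWitness[where f' = "\<lambda>z. - \<i> * z"]) (auto simp: norm_mult)
  qed (use rot q in auto)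
  also have "\<dots> = integral {0..2*pi} (\<lambda>\<theta>. Q (\<i> * cis \<theta>) * cos \<theta>)"
  proof (rule Disk_integral_deriv_x[where q' = "\<lambda>z. - q' (\<i> * z)"])
    have "((\<lambda>z. Q (\<i> * z)) has_derivative lin2 (q (\<i> * x)) (- q' (\<i> * x))) (at x)" if "x \<in> ball 0 1" for x
    proof (rule has_derivative_lin2_cong)
      have "\<i> * x \<in> ball 0 1" using that by (simp add: norm_mult)
      note dQ = D[OF this]
      have "((\<lambda>z. \<i> * z) has_derivative (\<lambda>h. \<i> * h)) (at x)"
        by (auto intro!: derivative_eq_intros)
      from has_derivative_compose[OF this dQ]
      show "((\<lambda>z. Q (\<i> * z)) has_derivative (\<lambda>h. lin2 (q' (\<i> * x)) (q (\<i> * x)) (\<i> * h))) (at x)" .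
    qed (auto simp: lin2_def)
    then show "C1_disk (\<lambda>z. Q (\<i> * z)) (\<lambda>z. q (\<i> * z)) (\<lambda>z. - q' (\<i> * z))"
      unfolding C1_disk_def
      by (auto intro!: continuous_on_minus continuous_on_compose2[OF Q] continuous_on_compose2[OF q] continuous_on_compose2[OF q'] rot)
  qed
  also have "\<dots> = integral {0..2*pi} ((\<lambda>\<theta>. Q (cis \<theta>) * sin \<theta>) \<circ> (\<lambda>\<theta>. \<theta> + pi/2))"
    by (rule integral_cong) (simp add: sin_add cis_mult[symmetric] mult.commute)
  also have "\<dots> = integral {0+pi/2..2*pi+pi/2} (\<lambda>\<theta>. Q (cis \<theta>) * sin \<theta>)"
    by (rule integral_shift) (auto intro!: continuous_intros continuous_on_compose2[OF Q] simp: Disk_iff)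
  also have "\<dots> = integral {0..0+2*pi} (\<lambda>\<theta>. Q (cis \<theta>) * sin \<theta>)"
  proof -
    have "cis (x + 2*pi) = cis x" for x by (simp add: complex_eq_iff)
    moreover have "continuous_on UNIV (\<lambda>\<theta>. Q (cis \<theta>) * sin \<theta>)"
      by (auto intro!: continuous_intros continuous_on_compose2[OF Q] simp: Disk_iff)
    ultimately show ?thesis
      using integral_periodic_shift[of "\<lambda>\<theta>. Q (cis \<theta>) * sin \<theta>" "2*pi" 0 "pi/2"] by (simp add: add.commute)
  qed
  finally show ?thesis by simp
qed

section \<open>Green's theorem for a primitive of the area form\<close>

lemma continuous_integrable_Disk:
  fixes f :: "complex \<Rightarrow> real"
  shows "continuous_on Disk f \<Longrightarrow> f integrable_on Disk"
  using integrable_compact_indicator(1)[OF compact_Disk, of f] set_borel_integral_eq_integral(1)[of Disk f]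
  by (simp add: set_integrable_def)

text \<open>Stokes' theorem for \<open>u \<eta>\<close>, since
  \<open>d(u \<eta>) = du \<and> \<eta> + u \<omega>\<close>. The left integrand is the coefficient
  of \<open>du \<and> \<eta>\<close>, and
  \<open>\<eta> (cis \<theta>) \<bullet> (\<i> * cis \<theta>)\<close> is \<eta> on the unit tangent
  of the circle.\<close>

lemma green_Disk:
  fixes u :: "complex \<Rightarrow> real" and \<eta> :: "complex \<Rightarrow> complex"
  assumes u: "C1_disk u u1 u2" and e: "C1_disk \<eta> e1 e2"
    and closed: "\<And>x. x \<in> ball 0 1 \<Longrightarrow> Im (e1 x) - Re (e2 x) = 1"
  shows "integral Disk (\<lambda>x. u1 x * Im (\<eta> x) - u2 x * Re (\<eta> x)) =
    integral {0..2*pi} (\<lambda>\<theta>. u (cis \<theta>) * (\<eta> (cis \<theta>) \<bullet> (\<i> * cis \<theta>))) - integral Disk u"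
proof -
  note [continuous_intros] = u[unfolded C1_disk_def, THEN conjunct1] u[unfolded C1_disk_def, THEN conjunct2, THEN conjunct1]
    u[unfolded C1_disk_def, THEN conjunct2, THEN conjunct2, THEN conjunct1]
    e[unfolded C1_disk_def, THEN conjunct1] e[unfolded C1_disk_def, THEN conjunct2, THEN conjunct1]
    e[unfolded C1_disk_def, THEN conjunct2, THEN conjunct2, THEN conjunct1]
  have du: "(u has_derivative lin2 (u1 x) (u2 x)) (at x)" and de: "(\<eta> has_derivative lin2 (e1 x) (e2 x)) (at x)"
    if "x \<in> ball 0 1" for x using u e that by (auto simp: C1_disk_def)
  have closed': "Im (e1 x) = 1 + Re (e2 x)" if "cmod x < 1" for x
    using closed[of x] that by simp
  define X where "X = (\<lambda>x. u1 x * Im (\<eta> x) + u x * Im (e1 x))"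
  define Y where "Y = (\<lambda>x. u2 x * Re (\<eta> x) + u x * Re (e2 x))"
  have "C1_disk (\<lambda>x. u x * Im (\<eta> x)) X (\<lambda>x. u2 x * Im (\<eta> x) + u x * Im (e2 x))"
    unfolding C1_disk_def X_def
    by (auto intro!: continuous_intros has_derivative_lin2_cong[OF has_derivative_mult[OF du has_derivative_Im[OF de]]])
  then have 1: "integral Disk X = integral {0..2*pi} (\<lambda>\<theta>. u (cis \<theta>) * Im (\<eta> (cis \<theta>)) * cos \<theta>)"
    by (rule Disk_integral_deriv_x)
  have "C1_disk (\<lambda>x. u x * Re (\<eta> x)) (\<lambda>x. u1 x * Re (\<eta> x) + u x * Re (e1 x)) Y"
    unfolding C1_disk_def Y_def
    by (auto intro!: continuous_intros has_derivative_lin2_cong[OF has_derivative_mult[OF du has_derivative_Re[OF de]]])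
  then have 2: "integral Disk Y = integral {0..2*pi} (\<lambda>\<theta>. u (cis \<theta>) * Re (\<eta> (cis \<theta>)) * sin \<theta>)"
    by (rule Disk_integral_deriv_y)
  have XY: "X integrable_on Disk" "Y integrable_on Disk" "u integrable_on Disk"
    unfolding X_def Y_def by (intro continuous_integrable_Disk continuous_intros)+
  have cs: "continuous_on {0..2*pi} (\<lambda>\<theta>. u (cis \<theta>))" "continuous_on {0..2*pi} (\<lambda>\<theta>. \<eta> (cis \<theta>))"
    by (auto intro!: continuous_on_compose2[OF u[unfolded C1_disk_def, THEN conjunct1]]
       continuous_on_compose2[OF e[unfolded C1_disk_def, THEN conjunct1]] continuous_intros simp: Disk_iff)
  \<comment> \<open>The identity \<open>d\<eta> = \<omega>\<close> is available in the open disk, so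
    the integrand is rewritten there; the circle is negligible.\<close>
  have "integral Disk (\<lambda>x. u1 x * Im (\<eta> x) - u2 x * Re (\<eta> x)) =
     integral (ball 0 1) (\<lambda>x. u1 x * Im (\<eta> x) - u2 x * Re (\<eta> x))"
    by (simp add: integral_ball_cball Disk_def)
  also have "\<dots> = integral (ball 0 1) (\<lambda>x. X x - Y x - u x)"
    by (rule integral_cong) (auto simp: X_def Y_def closed' algebra_simps)
  also have "\<dots> = integral Disk (\<lambda>x. X x - Y x - u x)"
    by (simp add: integral_ball_cball Disk_def)
  also have "\<dots> = integral Disk X - integral Disk Y - integral Disk u"
    using XY by (simp add: Henstock_Kurzweil_Integration.integral_diff integrable_diff)
  also have "integral Disk X - integral Disk Y = integral {0..2*pi}
      (\<lambda>\<theta>. u (cis \<theta>) * Im (\<eta> (cis \<theta>)) * cos \<theta> - u (cis \<theta>) * Re (\<eta> (cis \<theta>)) * sin \<theta>)"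
    unfolding 1 2
    by (rule Henstock_Kurzweil_Integration.integral_diff[symmetric]) (intro integrable_continuous_real continuous_intros cs)+
  also have "\<dots> = integral {0..2*pi} (\<lambda>\<theta>. u (cis \<theta>) * (\<eta> (cis \<theta>) \<bullet> (\<i> * cis \<theta>)))"
    by (rule integral_cong) (simp add: inner_complex_def algebra_simps)
  finally show ?thesis .
qed

section \<open>Symplectomorphisms of the disk\<close>

lemma smooth_openD:
  assumes "smooth_open U f"
  shows "open U" "continuous_on U f"
    and "x \<in> U \<Longrightarrow> (f has_derivative frechet_derivative f (at x)) (at x)"
    and "i \<in> Basis \<Longrightarrow> smooth_open U (\<lambda>x. frechet_derivative f (at x) i)"
proof -
  show U: "open U" using assms by (simp add: smooth_open_def)
  have C: "Ck_on k U f" for k using assms by (simp add: smooth_open_def)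
  show "continuous_on U f" using C[of 0] by simp
  have "f differentiable_on U" using C[of 1] by simp
  then show "x \<in> U \<Longrightarrow> (f has_derivative frechet_derivative f (at x)) (at x)"
    using U by (meson differentiable_on_eq_differentiable_at frechet_derivative_works)
  show "i \<in> Basis \<Longrightarrow> smooth_open U (\<lambda>x. frechet_derivative f (at x) i)"
    using U C[of "Suc k" for k] by (simp add: smooth_open_def)
qed

lemma ball_subset_Disk: "x \<in> ball 0 1 \<Longrightarrow> x \<in> Disk"
  by (simp add: Disk_def)

lemma interior_Disk: "interior Disk = ball 0 1"
  by (simp add: Disk_def)

text \<open>The partial derivatives are those of a smooth extension to a neighbourhood of the disk,
  which makes them continuous up to the circle.\<close>

lemma C1_disk_of_smooth:
  assumes "smooth_on_set Disk f"
  obtains f1 f2 where "C1_disk f f1 f2"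
proof -
  obtain U f' where U: "Disk \<subseteq> U" and f': "smooth_open U f'" and eq: "\<And>x. x \<in> Disk \<Longrightarrow> f' x = f x"
    using assms by (auto simp: smooth_on_set_def)
  note f'D = smooth_openD[OF f']
  have c: "continuous_on Disk (\<lambda>x. frechet_derivative f' (at x) i)" if "i \<in> Basis" for i
    by (rule continuous_on_subset[OF smooth_openD(2)[OF f'D(4)[OF that]] U])
  have "C1_disk f (\<lambda>x. frechet_derivative f' (at x) 1) (\<lambda>x. frechet_derivative f' (at x) \<i>)"
    unfolding C1_disk_def
  proof (intro conjI ballI c)
    show "continuous_on Disk f"
      using continuous_on_subset[OF f'D(2) U] eq by (metis (no_types, lifting) continuous_on_cong)
    fix x :: complex assume x: "x \<in> ball 0 1"
    have "(f' has_derivative lin2 (frechet_derivative f' (at x) 1) (frechet_derivative f' (at x) \<i>)) (at x)"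
      by (rule has_derivative_lin2_cong[OF f'D(3)]) (use x U ball_subset_Disk in auto)
    then show "(f has_derivative lin2 (frechet_derivative f' (at x) 1) (frechet_derivative f' (at x) \<i>)) (at x)"
      by (rule has_derivative_transform_within_open[OF _ open_ball x]) (use eq ball_subset_Disk in auto)
  qed (auto simp: Basis_complex_def)
  then show ?thesis by (rule that)
qed

lemma at_within_Disk: "x \<in> ball 0 1 \<Longrightarrow> at x within Disk = at x"
  by (rule at_within_interior) (simp add: interior_Disk)

lemma frechet_derivative_Disk:
  assumes "C1_disk f f1 f2" "x \<in> ball 0 1"
  shows "frechet_derivative f (at x within Disk) = lin2 (f1 x) (f2 x)"
  using assms by (simp add: at_within_Disk C1_disk_def frechet_derivative_at[symmetric])

lemma primitive_Disk:
  assumes "primitive \<eta>"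
  obtains e1 e2 where "C1_disk \<eta> e1 e2" "\<And>x. x \<in> ball 0 1 \<Longrightarrow> Im (e1 x) - Re (e2 x) = 1"
proof -
  obtain e1 e2 where e: "C1_disk \<eta> e1 e2"
    using assms C1_disk_of_smooth unfolding primitive_def by metis
  have "Im (e1 x) - Re (e2 x) = 1" if "x \<in> ball 0 1" for x
    using assms that ball_subset_Disk[OF that] by (auto simp: primitive_def frechet_derivative_Disk[OF e])
  with e show ?thesis by (rule that)
qed

text \<open>By invariance of domain the image of the open disk is open, hence contained in the
  interior of the disk.\<close>

lemma open_image_Disk:
  assumes "continuous_on Disk f" "inj_on f Disk" "f ` Disk \<subseteq> Disk"
  shows "f ` ball 0 1 \<subseteq> ball 0 1"
proof -
  have "open (f ` ball 0 1)"
    by (rule invariance_of_domain) (use assms in \<open>auto intro: continuous_on_subset inj_on_subset simp: Disk_def\<close>)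
  then have "f ` ball 0 1 \<subseteq> interior Disk"
    by (rule interior_maximal[rotated]) (use assms(3) ball_subset_Disk in auto)
  then show ?thesis by (simp add: interior_Disk)
qed

text \<open>Applying \<open>open_image_Disk\<close> to \<open>g\<close> and to its inverse shows
  that both preserve the open disk. A boundary point sent inside would be brought back inside by the
  inverse.\<close>

lemma Symp_image:
  assumes "g \<in> Symp"
  shows "bij_betw g Disk Disk" "continuous_on Disk g" "continuous_on Disk (inv_into Disk g)"
    and "bij_betw g (ball 0 1) (ball 0 1)" "cmod z = 1 \<Longrightarrow> cmod (g z) = 1"
proof -
  show bij: "bij_betw g Disk Disk" using assms by (simp add: Symp_def)
  obtain g1 g2 h1 h2 where "C1_disk g g1 g2" "C1_disk (inv_into Disk g) h1 h2"
    using assms C1_disk_of_smooth unfolding Symp_def by (metis (mono_tags, lifting) mem_Collect_eq)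
  then show c: "continuous_on Disk g" and ci: "continuous_on Disk (inv_into Disk g)"
    by (auto simp: C1_disk_def)
  have bi: "bij_betw (inv_into Disk g) Disk Disk" by (rule bij_betw_inv_into[OF bij])
  have s: "g ` ball 0 1 \<subseteq> ball 0 1" and si: "inv_into Disk g ` ball 0 1 \<subseteq> ball 0 1"
    using open_image_Disk[OF c] open_image_Disk[OF ci] bij bi by (auto simp: bij_betw_def)
  have li: "inv_into Disk g (g x) = x" and ri: "g (inv_into Disk g x) = x" if "x \<in> Disk" for x
    using bij that by (auto simp: bij_betw_def f_inv_into_f)
  show "bij_betw g (ball 0 1) (ball 0 1)"
    by (rule bij_betw_byWitness[where f' = "inv_into Disk g"]) (use s si li ri ball_subset_Disk in auto)
  show "cmod (g z) = 1" if z: "cmod z = 1"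
  proof (rule ccontr)
    have zD: "z \<in> Disk" using z by (simp add: Disk_iff)
    then have "g z \<in> Disk" using bij by (auto simp: bij_betw_def)
    moreover assume "cmod (g z) \<noteq> 1"
    ultimately have "g z \<in> ball 0 1" by (simp add: Disk_iff)
    then have "inv_into Disk g (g z) \<in> ball 0 1" using si by blast
    then show False using z li[OF zD] by simp
  qed
qed

lemma C1_disk_Symp_jac:
  assumes "g \<in> Symp" "C1_disk g g1 g2" "x \<in> ball 0 1"
  shows "Im (cnj (g1 x) * g2 x) = 1"
  using assms ball_subset_Disk[OF assms(3)]
  by (auto simp: Symp_def jac_def frechet_derivative_Disk Let_def)

lemma integral_Disk_Symp:
  fixes u :: "complex \<Rightarrow> real"
  assumes g: "g \<in> Symp" and u: "continuous_on Disk u"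
  shows "integral Disk (\<lambda>x. u (g x)) = integral Disk u"
proof -
  obtain g1 g2 where 1: "C1_disk g g1 g2" using g C1_disk_of_smooth unfolding Symp_def by blast
  show ?thesis
    by (rule integral_Disk_area_preserving[OF 1 Symp_image(4)[OF g] _ C1_disk_Symp_jac[OF g 1] u])
      (use Symp_image(1)[OF g] in \<open>auto simp: bij_betw_def\<close>)
qed

section \<open>Composition, iterates and telescoping of the primitive\<close>

lemma continuous_on_lin2[continuous_intros]:
  fixes a b :: "'a::topological_space \<Rightarrow> 'b::real_normed_vector"
  assumes "continuous_on S a" "continuous_on S b" "continuous_on S h"
  shows "continuous_on S (\<lambda>x. lin2 (a x) (b x) (h x))"
  unfolding lin2_def by (intro continuous_intros assms)

lemma C1_disk_compose:
  assumes u: "C1_disk u u1 u2" and g: "C1_disk g g1 g2"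
    and D: "g ` Disk \<subseteq> Disk" and B: "g ` ball 0 1 \<subseteq> ball 0 1"
  shows "C1_disk (\<lambda>x. u (g x)) (\<lambda>x. lin2 (u1 (g x)) (u2 (g x)) (g1 x)) (\<lambda>x. lin2 (u1 (g x)) (u2 (g x)) (g2 x))"
  unfolding C1_disk_def
proof (intro conjI ballI continuous_intros)
  have gc: "continuous_on Disk g" "continuous_on Disk g1" "continuous_on Disk g2"
    and uc: "continuous_on Disk u" "continuous_on Disk u1" "continuous_on Disk u2"
    using u g by (auto simp: C1_disk_def)
  show "continuous_on Disk g1" "continuous_on Disk g2" by fact+
  show "continuous_on Disk (\<lambda>x. u (g x))" "continuous_on Disk (\<lambda>x. u1 (g x))" "continuous_on Disk (\<lambda>x. u2 (g x))"
    "continuous_on Disk (\<lambda>x. u1 (g x))" "continuous_on Disk (\<lambda>x. u2 (g x))"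
    by (rule continuous_on_compose2[OF _ gc(1) D], fact)+
  fix x :: complex assume x: "x \<in> ball 0 1"
  then have "g x \<in> ball 0 1" using B by blast
  with x have "(g has_derivative lin2 (g1 x) (g2 x)) (at x)" "(u has_derivative lin2 (u1 (g x)) (u2 (g x))) (at (g x))"
    using u g unfolding C1_disk_def by blast+
  from has_derivative_compose[OF this]
  show "((\<lambda>x. u (g x)) has_derivative lin2 (lin2 (u1 (g x)) (u2 (g x)) (g1 x)) (lin2 (u1 (g x)) (u2 (g x)) (g2 x))) (at x)"
    by (rule has_derivative_lin2_cong) auto
qed

lemma C1_disk_add:
  assumes "C1_disk u u1 u2" "C1_disk v v1 v2"
  shows "C1_disk (\<lambda>x. u x + v x) (\<lambda>x. u1 x + v1 x) (\<lambda>x. u2 x + v2 x)"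
  using assms unfolding C1_disk_def
  by (auto intro!: continuous_intros has_derivative_lin2_cong[OF has_derivative_add])

lemma C1_disk_0: "C1_disk (\<lambda>x. 0) (\<lambda>x. 0) (\<lambda>x. 0)"
  unfolding C1_disk_def by (auto intro!: continuous_intros has_derivative_lin2_cong[OF has_derivative_const])

lemma C1_disk_cong:
  assumes u: "C1_disk u u1 u2" and eq: "\<And>x. x \<in> Disk \<Longrightarrow> u x = v x"
  shows "C1_disk v u1 u2"
  unfolding C1_disk_def
proof (intro conjI ballI)
  show "continuous_on Disk v"
    using u eq continuous_on_cong[OF refl, of Disk u v] by (auto simp: C1_disk_def)
  fix x :: complex assume x: "x \<in> ball 0 1"
  then have "(u has_derivative lin2 (u1 x) (u2 x)) (at x)" using u by (auto simp: C1_disk_def)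
  then show "(v has_derivative lin2 (u1 x) (u2 x)) (at x)"
    by (rule has_derivative_transform_within_open[OF _ open_ball x]) (use eq ball_subset_Disk in auto)
qed (use u in \<open>auto simp: C1_disk_def\<close>)

text \<open>With \<open>g1\<close>, \<open>g2\<close> the partial derivatives of \<open>g\<close>,
  this is the derivative of \<open>g ^^ n\<close> at \<open>x\<close> in the direction
  \<open>e\<close>, unrolled by the chain rule. The recursive form lets sums of pulled-back forms
  telescope.\<close>

fun iter_deriv :: "(complex \<Rightarrow> complex) \<Rightarrow> (complex \<Rightarrow> complex) \<Rightarrow> (complex \<Rightarrow> complex) \<Rightarrow> nat \<Rightarrow> complex \<Rightarrow> complex \<Rightarrow> complex" where
  "iter_deriv g g1 g2 0 e x = e"
| "iter_deriv g g1 g2 (Suc n) e x = lin2 (g1 ((g ^^ n) x)) (g2 ((g ^^ n) x)) (iter_deriv g g1 g2 n e x)"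

lemma funpow_image_subset:
  fixes g :: "'a \<Rightarrow> 'a"
  shows "g ` A \<subseteq> A \<Longrightarrow> (g ^^ n) ` A \<subseteq> A"
  by (induction n) auto

lemma C1_disk_funpow:
  assumes g: "C1_disk g g1 g2" and D: "g ` Disk \<subseteq> Disk" and B: "g ` ball 0 1 \<subseteq> ball 0 1"
  shows "C1_disk (g ^^ n) (iter_deriv g g1 g2 n 1) (iter_deriv g g1 g2 n \<i>)"
proof (induction n)
  case 0
  show ?case
    unfolding C1_disk_def
    by (auto simp: id_def intro!: continuous_intros has_derivative_lin2_cong[OF has_derivative_ident])
next
  case (Suc n)
  show ?case
    using C1_disk_compose[OF g Suc funpow_image_subset[OF D] funpow_image_subset[OF B]]
    by (simp add: o_def)
qed

lemma lin2_inner: "lin2 (v \<bullet> a) (v \<bullet> b) h = v \<bullet> lin2 a b h"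
  by (simp add: lin2_def inner_add_right)

lemma lin2_diff: "lin2 (a - a') (b - b') h = lin2 a b h - lin2 a' b' h"
  by (simp add: lin2_def algebra_simps)

lemma lin2_id: "lin2 1 \<i> h = h"
  by (simp add: lin2_def complex_eq_iff)

text \<open>The assumptions on \<open>k1\<close>, \<open>k2\<close> say that \<open>dK\<close> is
  the pullback of \<eta> by \<phi> minus \<eta>. Summing \<open>K\<close> along orbits gives a
  primitive for the iterate \<open>\<phi> ^^ n\<close>; Green's theorem then leaves a circle
  integral minus the area integral of the sum, and each summand has the integral of \<open>K\<close>
  by area invariance.\<close>

lemma tau_funpow:
  assumes phi: "\<phi> \<in> Symp" and p: "C1_disk \<phi> p1 p2"
    and e: "C1_disk \<eta> e1 e2" and cl: "\<And>x. x \<in> ball 0 1 \<Longrightarrow> Im (e1 x) - Re (e2 x) = 1"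
    and K: "C1_disk K k1 k2"
    and k1: "\<And>x. x \<in> ball 0 1 \<Longrightarrow> k1 x = \<eta> (\<phi> x) \<bullet> p1 x - \<eta> x \<bullet> 1"
    and k2: "\<And>x. x \<in> ball 0 1 \<Longrightarrow> k2 x = \<eta> (\<phi> x) \<bullet> p2 x - \<eta> x \<bullet> \<i>"
  shows "tau \<eta> (\<phi> ^^ n) =
    integral {0..2*pi} (\<lambda>\<theta>. (\<Sum>i<n. K ((\<phi> ^^ i) (cis \<theta>))) * (\<eta> (cis \<theta>) \<bullet> (\<i> * cis \<theta>))) - real n * integral Disk K"
proof -
  have D: "\<phi> ` Disk \<subseteq> Disk" and B: "\<phi> ` ball 0 1 \<subseteq> ball 0 1"
    using Symp_image(1,4)[OF phi] by (auto simp: bij_betw_def)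
  note fD = funpow_image_subset[OF D] and fB = funpow_image_subset[OF B]
  define P where "P = iter_deriv \<phi> p1 p2"
  have P: "C1_disk (\<phi> ^^ m) (P m 1) (P m \<i>)" for m
    unfolding P_def by (rule C1_disk_funpow[OF p D B])
  \<comment> \<open>\<open>q i e x\<close> is the differential of
    \<open>\<lambda>x. K ((\<phi> ^^ i) x)\<close> at \<open>x\<close>, applied to
    \<open>e\<close>.\<close>
  define q where "q i e x = lin2 (k1 ((\<phi> ^^ i) x)) (k2 ((\<phi> ^^ i) x)) (P i e x)" for i e x
  have q: "(\<Sum>i<m. q i e x) = \<eta> ((\<phi> ^^ m) x) \<bullet> P m e x - \<eta> x \<bullet> e" if "x \<in> ball 0 1" for m e x
  proof -
    have "q i e x = \<eta> ((\<phi> ^^ Suc i) x) \<bullet> P (Suc i) e x - \<eta> ((\<phi> ^^ i) x) \<bullet> P i e x" for i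
    proof -
      have "(\<phi> ^^ i) x \<in> ball 0 1" using fB that by blast
      then show ?thesis by (simp only: q_def k1 k2 lin2_diff lin2_inner lin2_id) (simp add: P_def)
    qed
    then have "(\<Sum>i<m. q i e x) = (\<Sum>i<m. \<eta> ((\<phi> ^^ Suc i) x) \<bullet> P (Suc i) e x - \<eta> ((\<phi> ^^ i) x) \<bullet> P i e x)"
      by simp
    also have "\<dots> = \<eta> ((\<phi> ^^ m) x) \<bullet> P m e x - \<eta> ((\<phi> ^^ 0) x) \<bullet> P 0 e x"
      by (rule sum_lessThan_telescope)
    finally show ?thesis by (simp add: P_def)
  qed
  have Kn: "C1_disk (\<lambda>x. \<Sum>i<m. K ((\<phi> ^^ i) x)) (\<lambda>x. \<Sum>i<m. q i 1 x) (\<lambda>x. \<Sum>i<m. q i \<i> x)" for m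
  proof (induction m)
    case 0 show ?case by (simp add: C1_disk_0)
  next
    case (Suc m)
    from C1_disk_add[OF Suc C1_disk_compose[OF K P fD fB]] show ?case
      by (simp add: q_def)
  qed
  have Kc: "continuous_on Disk (\<lambda>x. K ((\<phi> ^^ i) x))" for i
    using C1_disk_compose[OF K P fD fB] by (simp add: C1_disk_def)
  have Ki: "integral Disk (\<lambda>x. K ((\<phi> ^^ i) x)) = integral Disk K" for i
  proof (induction i)
    case (Suc i)
    have "integral Disk (\<lambda>x. K ((\<phi> ^^ Suc i) x)) = integral Disk (\<lambda>x. K ((\<phi> ^^ i) (\<phi> x)))"
      by (simp only: funpow_Suc_right o_apply)
    also have "\<dots> = integral Disk (\<lambda>x. K ((\<phi> ^^ i) x))"
      by (rule integral_Disk_Symp[OF phi Kc])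
    finally show ?case using Suc by simp
  qed simp
  have "tau \<eta> (\<phi> ^^ n) = integral (ball 0 1) (\<lambda>p. let L = frechet_derivative (\<phi> ^^ n) (at p within Disk) in
      (\<eta> ((\<phi> ^^ n) p) \<bullet> L 1) * (\<eta> p \<bullet> \<i>) - (\<eta> ((\<phi> ^^ n) p) \<bullet> L \<i>) * (\<eta> p \<bullet> 1))"
    by (simp add: tau_def Disk_def integral_ball_cball)
  also have "\<dots> = integral (ball 0 1) (\<lambda>x. (\<Sum>i<n. q i 1 x) * Im (\<eta> x) - (\<Sum>i<n. q i \<i> x) * Re (\<eta> x))"
  proof (rule integral_cong)
    fix x :: complex assume x: "x \<in> ball 0 1"
    \<comment> \<open>Subtracting \<eta> from its pullback does not change the integrand, because
      \<open>\<eta> \<and> \<eta> = 0\<close>.\<close>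
    show "(let L = frechet_derivative (\<phi> ^^ n) (at x within Disk) in
      (\<eta> ((\<phi> ^^ n) x) \<bullet> L 1) * (\<eta> x \<bullet> \<i>) - (\<eta> ((\<phi> ^^ n) x) \<bullet> L \<i>) * (\<eta> x \<bullet> 1)) =
      (\<Sum>i<n. q i 1 x) * Im (\<eta> x) - (\<Sum>i<n. q i \<i> x) * Re (\<eta> x)"
      unfolding frechet_derivative_Disk[OF P x] Let_def q[OF x] by (simp add: algebra_simps)
  qed
  also have "\<dots> = integral Disk (\<lambda>x. (\<Sum>i<n. q i 1 x) * Im (\<eta> x) - (\<Sum>i<n. q i \<i> x) * Re (\<eta> x))"
    by (simp add: Disk_def integral_ball_cball)
  also have "\<dots> = integral {0..2*pi} (\<lambda>\<theta>. (\<Sum>i<n. K ((\<phi> ^^ i) (cis \<theta>))) * (\<eta> (cis \<theta>) \<bullet> (\<i> * cis \<theta>)))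
     - integral Disk (\<lambda>x. \<Sum>i<n. K ((\<phi> ^^ i) x))"
    by (rule green_Disk[OF Kn e cl])
  also have "integral Disk (\<lambda>x. \<Sum>i<n. K ((\<phi> ^^ i) x)) = real n * integral Disk K"
    by (subst integral_sum) (auto intro: continuous_integrable_Disk Kc simp: Ki)
  finally show ?thesis .
qed

section \<open>Isotopies and their Hamiltonians\<close>

lemma has_derivative_integral_lin2:
  fixes f :: "complex \<Rightarrow> real \<Rightarrow> 'b::banach"
  assumes f: "\<And>x t. x \<in> U \<Longrightarrow> t \<in> {a..b} \<Longrightarrow> ((\<lambda>x. f x t) has_derivative lin2 (f1 x t) (f2 x t)) (at x)"
    and c: "\<And>x. x \<in> U \<Longrightarrow> continuous_on {a..b} (f x)"
    and c1: "continuous_on (U \<times> {a..b}) (\<lambda>(x, t). f1 x t)" and c2: "continuous_on (U \<times> {a..b}) (\<lambda>(x, t). f2 x t)"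
    and U: "open U" "convex U" "x0 \<in> U"
  shows "((\<lambda>x. integral {a..b} (f x)) has_derivative lin2 (integral {a..b} (f1 x0)) (integral {a..b} (f2 x0))) (at x0)"
proof (rule has_derivative_lin2_cong)
  \<comment> \<open>The Leibniz rule expects a derivative with values in bounded linear maps, so the
    two partial derivatives are packed into one.\<close>
  let ?A = "\<lambda>x t. (blinfun_scaleR_left (f1 x t) o\<^sub>L Blinfun Re) + (blinfun_scaleR_left (f2 x t) o\<^sub>L Blinfun Im)"
  have app: "blinfun_apply (?A x t) = lin2 (f1 x t) (f2 x t)" for x t
    by (rule ext) (simp add: lin2_def plus_blinfun.rep_eq bounded_linear_Blinfun_apply bounded_linear_Re bounded_linear_Im)
  have cont: "continuous_on (U \<times> cbox a b) (\<lambda>(x, t). ?A x t)"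
    using c1 c2 by (auto simp: case_prod_beta'
      intro!: continuous_intros bounded_bilinear.continuous_on[OF bounded_bilinear_blinfun_compose]
        bounded_linear.continuous_on[OF bounded_linear_blinfun_scaleR_left])
  have "((\<lambda>x. integral (cbox a b) (f x)) has_derivative integral (cbox a b) (?A x0)) (at x0 within U)"
  proof (rule leibniz_rule[OF _ _ cont U(3,2)])
    show "((\<lambda>x. f x t) has_derivative blinfun_apply (?A x t)) (at x within U)" if "x \<in> U" "t \<in> cbox a b" for x t
      unfolding app by (rule has_derivative_at_withinI[OF f]) (use that in auto)
    show "f x integrable_on cbox a b" if "x \<in> U" for x
      using c[OF that] by (simp add: integrable_continuous_real)
  qed
  then show "((\<lambda>x. integral {a..b} (f x)) has_derivative blinfun_apply (integral {a..b} (?A x0))) (at x0)"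
    by (simp only: cbox_interval at_within_open[OF U(3,1)])
  have "continuous_on {a..b} (\<lambda>t. ?A x0 t)"
  proof -
    have "continuous_on {a..b} (\<lambda>t. case (x0, t) of (x, t) \<Rightarrow> ?A x t)"
      by (rule continuous_on_compose2[OF cont]) (use U in \<open>auto intro!: continuous_intros\<close>)
    then show ?thesis by (simp only: split)
  qed
  then have i: "?A x0 integrable_on {a..b}" by (rule integrable_continuous_real)
  have "blinfun_apply (integral {a..b} (?A x0)) h = integral {a..b} (\<lambda>t. lin2 (f1 x0 t) (f2 x0 t) h)" for h
    using integral_linear[OF i, of "\<lambda>B. blinfun_apply B h"] by (simp only: o_def app blinfun.bounded_linear_left)
  then show "blinfun_apply (integral {a..b} (?A x0)) 1 = integral {a..b} (f1 x0)"
    "blinfun_apply (integral {a..b} (?A x0)) \<i> = integral {a..b} (f2 x0)" by (simp_all only: lin2_simps)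
qed

lemma smooth_open_partials:
  fixes f :: "real \<times> complex \<Rightarrow> 'b::real_normed_vector"
  assumes f: "smooth_open U f" and tx: "(t, x) \<in> U"
  defines "D \<equiv> frechet_derivative f (at (t, x))"
  shows "((\<lambda>x. f (t, x)) has_derivative lin2 (D (0, 1)) (D (0, \<i>))) (at x)"
    and "((\<lambda>t. f (t, x)) has_vector_derivative D (1, 0)) (at t within S)"
proof -
  have d: "(f has_derivative D) (at (t, x))" unfolding D_def by (rule smooth_openD(3)[OF f tx])
  have "((\<lambda>x. (t, x)) has_derivative (\<lambda>h. (0, h))) (at x)" by (auto intro!: derivative_eq_intros)
  from has_derivative_compose[OF this d]
  show "((\<lambda>x. f (t, x)) has_derivative lin2 (D (0, 1)) (D (0, \<i>))) (at x)"
    by (rule has_derivative_lin2_cong) auto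
  have "((\<lambda>t. (t, x)) has_vector_derivative (1, 0)) (at t within S)"
    unfolding has_vector_derivative_def by (auto intro!: derivative_eq_intros)
  from vector_derivative_diff_chain_within[OF this has_derivative_at_withinI[OF d]]
  show "((\<lambda>t. f (t, x)) has_vector_derivative D (1, 0)) (at t within S)" by (simp add: o_def)
qed

text \<open>\<open>V (t, x)\<close> is the velocity \<open>X\<^sub>t(g\<^sub>t x)\<close>, and the last two conjuncts state that mixed partial
  derivatives commute.\<close>
definition isotopy_derivs :: "(real \<Rightarrow> complex \<Rightarrow> complex) \<Rightarrow> (real \<times> complex \<Rightarrow> complex) \<Rightarrow> (real \<times> complex \<Rightarrow> complex) \<Rightarrow>
   (real \<times> complex \<Rightarrow> complex) \<Rightarrow> (real \<times> complex \<Rightarrow> complex) \<Rightarrow> (real \<times> complex \<Rightarrow> complex) \<Rightarrow> bool" where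
  "isotopy_derivs g V W1 W2 V1 V2 \<longleftrightarrow>
     continuous_on ({0..1} \<times> Disk) (\<lambda>p. g (fst p) (snd p)) \<and>
     continuous_on ({0..1} \<times> Disk) V \<and> continuous_on ({0..1} \<times> Disk) W1 \<and> continuous_on ({0..1} \<times> Disk) W2 \<and>
     continuous_on ({0..1} \<times> Disk) V1 \<and> continuous_on ({0..1} \<times> Disk) V2 \<and>
     (\<forall>t\<in>{0..1}. \<forall>x\<in>Disk. ((\<lambda>s. g s x) has_vector_derivative V (t, x)) (at t within {0..1})) \<and>
     (\<forall>t\<in>{0..1}. \<forall>x\<in>ball 0 1. (g t has_derivative lin2 (W1 (t, x)) (W2 (t, x))) (at x)) \<and>
     (\<forall>t\<in>{0..1}. \<forall>x\<in>ball 0 1. ((\<lambda>x. V (t, x)) has_derivative lin2 (V1 (t, x)) (V2 (t, x))) (at x)) \<and>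
     (\<forall>t\<in>{0..1}. \<forall>x\<in>ball 0 1. ((\<lambda>s. W1 (s, x)) has_vector_derivative V1 (t, x)) (at t within {0..1})) \<and>
     (\<forall>t\<in>{0..1}. \<forall>x\<in>ball 0 1. ((\<lambda>s. W2 (s, x)) has_vector_derivative V2 (t, x)) (at t within {0..1}))"

text \<open>For the mixed partials, \<open>g t = g 0 + \<integral> V ds\<close> is differentiated in
  space under the integral sign. This writes \<open>W1\<close> and \<open>W2\<close> as time
  integrals of \<open>V1\<close> and \<open>V2\<close>, and their time derivatives follow from the
  fundamental theorem of calculus.\<close>

lemma isotopy_derivs_exist:
  assumes "symp_path g"
  obtains V W1 W2 V1 V2 where "isotopy_derivs g V W1 W2 V1 V2"
proof -
  obtain U G where U: "{0..1} \<times> Disk \<subseteq> U" and G: "smooth_open U G"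
    and eq: "\<And>t x. t \<in> {0..1} \<Longrightarrow> x \<in> Disk \<Longrightarrow> G (t, x) = g t x"
    using assms unfolding symp_path_def smooth_on_set_def by (fastforce simp: split_def)
  define V where "V p = frechet_derivative G (at p) (1, 0)" for p
  define W1 where "W1 p = frechet_derivative G (at p) (0, 1)" for p
  define W2 where "W2 p = frechet_derivative G (at p) (0, \<i>)" for p
  define V1 where "V1 p = frechet_derivative V (at p) (0, 1)" for p
  define V2 where "V2 p = frechet_derivative V (at p) (0, \<i>)" for p
  have B: "(1, 0) \<in> (Basis :: (real \<times> complex) set)" "(0, 1) \<in> (Basis :: (real \<times> complex) set)"
    "(0, \<i>) \<in> (Basis :: (real \<times> complex) set)"
    by (auto simp: Basis_prod_def Basis_complex_def)
  have S: "smooth_open U V" "smooth_open U W1" "smooth_open U W2"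
    unfolding V_def W1_def W2_def by (intro smooth_openD(4)[OF G] B)+
  have S': "smooth_open U V1" "smooth_open U V2"
    unfolding V1_def V2_def by (intro smooth_openD(4)[OF S(1)] B)+
  have c: "continuous_on ({0..1} \<times> Disk) f" if "smooth_open U f" for f :: "real \<times> complex \<Rightarrow> complex"
    using continuous_on_subset[OF smooth_openD(2)[OF that] U] .
  have cg: "continuous_on ({0..1} \<times> Disk) (\<lambda>p. g (fst p) (snd p))"
    using c[OF G] by (rule continuous_on_eq) (use eq in auto)
  have inU: "(t, x) \<in> U" if "t \<in> {0..1}" "x \<in> Disk" for t x using U that by blast
  have dt: "((\<lambda>s. g s x) has_vector_derivative V (t, x)) (at t within {0..1})" if t: "t \<in> {0..1}" and x: "x \<in> Disk" for t x
    using smooth_open_partials(2)[OF G inU[OF t x], of "{0..1}"] unfolding V_def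
    by (rule has_vector_derivative_transform[OF t, rotated]) (use eq x in auto)
  have dx: "(g t has_derivative lin2 (W1 (t, x)) (W2 (t, x))) (at x)" if t: "t \<in> {0..1}" and x: "x \<in> ball 0 1" for t x
    using smooth_open_partials(1)[OF G inU[OF t ball_subset_Disk[OF x]]] unfolding W1_def W2_def
    by (rule has_derivative_transform_within_open[OF _ open_ball x]) (use t eq ball_subset_Disk in auto)
  have dV: "((\<lambda>x. V (t, x)) has_derivative lin2 (V1 (t, x)) (V2 (t, x))) (at x)" if t: "t \<in> {0..1}" and x: "x \<in> ball 0 1" for t x
    using smooth_open_partials(1)[OF S(1) inU[OF t ball_subset_Disk[OF x]]] unfolding V1_def V2_def .
  have cs: "continuous_on {0..t} (\<lambda>s. f (s, x))" if "smooth_open U f" "t \<le> 1" "x \<in> Disk" for f :: "real \<times> complex \<Rightarrow> complex" and t x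
    by (rule continuous_on_compose2[OF c[OF that(1)]]) (use that in \<open>auto intro!: continuous_intros\<close>)
  have cs': "continuous_on (ball 0 1 \<times> {0..t}) (\<lambda>(x, s). f (s, x))" if "smooth_open U f" "t \<le> 1" for f :: "real \<times> complex \<Rightarrow> complex" and t
    unfolding case_prod_beta'
    by (rule continuous_on_compose2[OF c[OF that(1)]]) (use that in \<open>auto intro!: continuous_intros simp: Disk_iff\<close>)
  have W: "W1 (t, x) = W1 (0, x) + integral {0..t} (\<lambda>s. V1 (s, x))" "W2 (t, x) = W2 (0, x) + integral {0..t} (\<lambda>s. V2 (s, x))"
    if t: "t \<in> {0..1}" and x: "x \<in> ball 0 1" for t x
  proof -
    have g: "g 0 y + integral {0..t} (\<lambda>s. V (s, y)) = g t y" if y: "y \<in> ball 0 1" for y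
    proof -
      have "((\<lambda>s. V (s, y)) has_integral g t y - g 0 y) {0..t}"
        using t by (intro fundamental_theorem_of_calculus)
          (auto intro!: has_vector_derivative_within_subset[OF dt] ball_subset_Disk[OF y])
      then show ?thesis by (simp add: integral_unique)
    qed
    have "((\<lambda>y. integral {0..t} (\<lambda>s. V (s, y))) has_derivative
       lin2 (integral {0..t} (\<lambda>s. V1 (s, x))) (integral {0..t} (\<lambda>s. V2 (s, x)))) (at x)"
      using t by (intro has_derivative_integral_lin2[where U = "ball 0 1"] dV cs' S S' cs x) (auto simp: Disk_iff)
    moreover have "(g 0 has_derivative lin2 (W1 (0, x)) (W2 (0, x))) (at x)" by (rule dx[OF _ x]) simp
    ultimately have "((\<lambda>y. g 0 y + integral {0..t} (\<lambda>s. V (s, y))) has_derivative (\<lambda>h. lin2 (W1 (0, x)) (W2 (0, x)) h +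
         lin2 (integral {0..t} (\<lambda>s. V1 (s, x))) (integral {0..t} (\<lambda>s. V2 (s, x))) h)) (at x)"
      by (intro has_derivative_add)
    then
    have "(g t has_derivative (\<lambda>h. lin2 (W1 (0, x)) (W2 (0, x)) h +
         lin2 (integral {0..t} (\<lambda>s. V1 (s, x))) (integral {0..t} (\<lambda>s. V2 (s, x))) h)) (at x)"
      by (rule has_derivative_transform_within_open[OF _ open_ball x g])
    from has_derivative_unique[OF dx[OF t x] this]
    have e: "lin2 (W1 (t, x)) (W2 (t, x)) h = lin2 (W1 (0, x)) (W2 (0, x)) h +
         lin2 (integral {0..t} (\<lambda>s. V1 (s, x))) (integral {0..t} (\<lambda>s. V2 (s, x))) h" for h by metis
    from e[of 1] e[of \<i>]
    show "W1 (t, x) = W1 (0, x) + integral {0..t} (\<lambda>s. V1 (s, x))" "W2 (t, x) = W2 (0, x) + integral {0..t} (\<lambda>s. V2 (s, x))"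
      by simp_all
  qed
  have mix: "((\<lambda>s. Wi (s, x)) has_vector_derivative Vi (t, x)) (at t within {0..1})"
    if Vi: "smooth_open U Vi" and t: "t \<in> {0..1}" and x: "x \<in> ball 0 1"
      and Wi: "\<And>t. t \<in> {0..1} \<Longrightarrow> Wi (t, x) = Wi (0, x) + integral {0..t} (\<lambda>s. Vi (s, x))"
    for Wi Vi :: "real \<times> complex \<Rightarrow> complex" and t x
  proof (rule has_vector_derivative_transform[OF t Wi])
    have "((\<lambda>u. integral {0..u} (\<lambda>s. Vi (s, x))) has_vector_derivative Vi (t, x)) (at t within {0..1})"
      by (rule integral_has_vector_derivative[OF cs[OF Vi] t]) (use x ball_subset_Disk in auto)
    from has_vector_derivative_add[OF has_vector_derivative_const[of "Wi (0, x)"] this]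
    show "((\<lambda>t. Wi (0, x) + integral {0..t} (\<lambda>s. Vi (s, x))) has_vector_derivative Vi (t, x)) (at t within {0..1})"
      by simp
  qed
  have mix1: "((\<lambda>s. W1 (s, x)) has_vector_derivative V1 (t, x)) (at t within {0..1})"
    and mix2: "((\<lambda>s. W2 (s, x)) has_vector_derivative V2 (t, x)) (at t within {0..1})"
    if t: "t \<in> {0..1}" and x: "x \<in> ball 0 1" for t x
    by (rule mix[OF S'(1) t x W(1)[OF _ x]], assumption) (rule mix[OF S'(2) t x W(2)[OF _ x]], assumption)
  have "isotopy_derivs g V W1 W2 V1 V2"
    unfolding isotopy_derivs_def
    by (intro conjI ballI cg c S S'; (rule dt dx dV mix1 mix2; assumption))
  then show ?thesis by (rule that)
qed

section \<open>Hamiltonian, action and Cartan's formula\<close>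

locale hamiltonian_isotopy =
  fixes g :: "real \<Rightarrow> complex \<Rightarrow> complex" and H :: "real \<Rightarrow> complex \<Rightarrow> real"
    and V W1 W2 V1 V2 :: "real \<times> complex \<Rightarrow> complex" and \<eta> e1 e2 :: "complex \<Rightarrow> complex"
  assumes iso: "isotopy_derivs g V W1 W2 V1 V2"
    and Symp: "t \<in> {0..1} \<Longrightarrow> g t \<in> Symp"
    and g_0: "x \<in> Disk \<Longrightarrow> g 0 x = x"
    and ham: "hamiltonian_of g H"
    and eta: "C1_disk \<eta> e1 e2" and d_eta: "x \<in> ball 0 1 \<Longrightarrow> Im (e1 x) - Re (e2 x) = 1"
begin

lemma cont_isotopy:
  shows "continuous_on ({0..1} \<times> Disk) (\<lambda>p. g (fst p) (snd p))"
    "continuous_on ({0..1} \<times> Disk) V" "continuous_on ({0..1} \<times> Disk) W1" "continuous_on ({0..1} \<times> Disk) W2"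
    "continuous_on ({0..1} \<times> Disk) V1" "continuous_on ({0..1} \<times> Disk) V2"
  using iso by (auto simp: isotopy_derivs_def)

lemma deriv_isotopy:
  assumes "t \<in> {0..1}"
  shows "x \<in> Disk \<Longrightarrow> ((\<lambda>s. g s x) has_vector_derivative V (t, x)) (at t within {0..1})"
    "x \<in> ball 0 1 \<Longrightarrow> (g t has_derivative lin2 (W1 (t, x)) (W2 (t, x))) (at x)"
    "x \<in> ball 0 1 \<Longrightarrow> ((\<lambda>x. V (t, x)) has_derivative lin2 (V1 (t, x)) (V2 (t, x))) (at x)"
    "x \<in> ball 0 1 \<Longrightarrow> ((\<lambda>s. W1 (s, x)) has_vector_derivative V1 (t, x)) (at t within {0..1})"
    "x \<in> ball 0 1 \<Longrightarrow> ((\<lambda>s. W2 (s, x)) has_vector_derivative V2 (t, x)) (at t within {0..1})"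
  using iso assms unfolding isotopy_derivs_def by blast+

lemma cont_slice:
  assumes "continuous_on ({0..1} \<times> Disk) f"
  shows "t \<in> {0..1} \<Longrightarrow> continuous_on Disk (\<lambda>x. f (t, x))"
    and "x \<in> Disk \<Longrightarrow> continuous_on {0..1} (\<lambda>t. f (t, x))"
  by (auto intro!: continuous_on_compose2[OF assms] continuous_intros)

lemma g_maps: "t \<in> {0..1} \<Longrightarrow> x \<in> Disk \<Longrightarrow> g t x \<in> Disk" "t \<in> {0..1} \<Longrightarrow> x \<in> ball 0 1 \<Longrightarrow> g t x \<in> ball 0 1"
  using Symp_image(1,4)[OF Symp, of t] by (auto simp: bij_betw_def)

lemma gdot_eq: "t \<in> {0..1} \<Longrightarrow> x \<in> Disk \<Longrightarrow> gdot g t x = V (t, x)"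
  unfolding gdot_def using deriv_isotopy(1)[of t x]
  by (intro vector_derivative_within_closed_interval) auto

lemma H_boundary: "t \<in> {0..1} \<Longrightarrow> cmod z = 1 \<Longrightarrow> H t z = 0"
  using ham by (simp add: hamiltonian_of_def)

lemma H_deriv:
  assumes "t \<in> {0..1}" "x \<in> Disk"
  shows "(H t has_derivative (\<lambda>h. (\<i> * V (t, x)) \<bullet> h)) (at (g t x) within Disk)"
proof -
  have "(H t has_derivative (\<lambda>h. (\<i> * gdot g t x) \<bullet> h)) (at (g t x) within Disk)"
    using ham assms unfolding hamiltonian_of_def by blast
  then show ?thesis by (simp only: gdot_eq[OF assms])
qed

text \<open>\<open>hamiltonian_of\<close> prescribes the gradient \<open>\<i> * X\<close> of
  \<open>H t\<close> at the moved points \<open>g t x\<close>; inverting \<open>g t\<close> on the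
  disk gives it everywhere. Its components are \<open>- Im X\<close> and
  \<open>Re X\<close>.\<close>

lemma C1_H:
  assumes t: "t \<in> {0..1}"
  shows "C1_disk (H t) (\<lambda>y. - Im (V (t, inv_into Disk (g t) y))) (\<lambda>y. Re (V (t, inv_into Disk (g t) y)))"
proof -
  let ?i = "inv_into Disk (g t)"
  have inv: "?i y \<in> Disk" "g t (?i y) = y" if "y \<in> Disk" for y
    using Symp_image(1)[OF Symp[OF t]] that by (auto simp: bij_betw_def f_inv_into_f inv_into_into)
  have d: "(H t has_derivative (\<lambda>h. (\<i> * V (t, ?i y)) \<bullet> h)) (at y within Disk)" if "y \<in> Disk" for y
    using H_deriv[OF t inv(1)[OF that]] inv(2)[OF that] by simp
  have cV: "continuous_on Disk (\<lambda>y. V (t, ?i y))"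
    by (rule continuous_on_compose2[OF cont_slice(1)[OF cont_isotopy(2) t] Symp_image(3)[OF Symp[OF t]]])
      (use inv in auto)
  show ?thesis
    unfolding C1_disk_def
  proof (intro conjI ballI continuous_intros cV)
    show "continuous_on Disk (H t)"
      using d by (auto simp: continuous_on_eq_continuous_within intro: has_derivative_continuous)
    fix y :: complex assume y: "y \<in> ball 0 1"
    have "(H t has_derivative (\<lambda>h. (\<i> * V (t, ?i y)) \<bullet> h)) (at y)"
      using d[OF ball_subset_Disk[OF y]] by (simp add: at_within_Disk[OF y])
    then show "(H t has_derivative lin2 (- Im (V (t, ?i y))) (Re (V (t, ?i y)))) (at y)"
      by (rule has_derivative_lin2_cong) (auto simp: inner_complex_def)
  qed
qed

text \<open>Moving to the points \<open>y = g t x\<close> preserves area, and there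
  \<open>\<eta>(X)\<close> is minus the coefficient of \<open>dH \<and> \<eta>\<close>. In Green's
  theorem for \<open>H t\<close> the circle term vanishes.\<close>

lemma integral_eta_V:
  assumes t: "t \<in> {0..1}"
  shows "integral Disk (\<lambda>x. \<eta> (g t x) \<bullet> V (t, x)) = integral Disk (H t)"
proof -
  let ?i = "inv_into Disk (g t)"
  have bij: "bij_betw (g t) Disk Disk" by (rule Symp_image(1)[OF Symp[OF t]])
  have cV: "continuous_on Disk (\<lambda>y. V (t, ?i y))"
    by (rule continuous_on_compose2[OF cont_slice(1)[OF cont_isotopy(2) t] Symp_image(3)[OF Symp[OF t]]])
      (use bij in \<open>auto simp: bij_betw_def inv_into_into\<close>)
  have ec: "continuous_on Disk \<eta>" using eta by (simp add: C1_disk_def)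
  have "integral Disk (\<lambda>x. \<eta> (g t x) \<bullet> V (t, x)) = integral Disk (\<lambda>x. \<eta> (g t x) \<bullet> V (t, ?i (g t x)))"
    using bij by (intro integral_cong) (simp add: bij_betw_def)
  also have "\<dots> = integral Disk (\<lambda>y. \<eta> y \<bullet> V (t, ?i y))"
    by (rule integral_Disk_Symp[OF Symp[OF t]]) (intro continuous_intros ec cV)
  also have "\<dots> = - integral Disk (\<lambda>y. - Im (V (t, ?i y)) * Im (\<eta> y) - Re (V (t, ?i y)) * Re (\<eta> y))"
    by (subst Henstock_Kurzweil_Integration.integral_neg[symmetric])
      (simp add: inner_complex_def algebra_simps)
  also have "\<dots> = integral Disk (H t)"
    by (subst green_Disk[OF C1_H[OF t] eta d_eta]) (simp_all add: H_boundary[OF t])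
  finally show ?thesis .
qed

definition pulled_ham :: "real \<times> complex \<Rightarrow> real" where
  "pulled_ham p = H (fst p) (g (fst p) (snd p))"

lemma pulled_ham_deriv:
  assumes t: "t \<in> {0..1}" and x: "x \<in> ball 0 1"
  shows "((\<lambda>x. pulled_ham (t, x)) has_derivative lin2 ((\<i> * V (t, x)) \<bullet> W1 (t, x)) ((\<i> * V (t, x)) \<bullet> W2 (t, x))) (at x)"
proof -
  have "(H t has_derivative (\<lambda>h. (\<i> * V (t, x)) \<bullet> h)) (at (g t x))"
    using H_deriv[OF t ball_subset_Disk[OF x]] by (simp only: at_within_Disk[OF g_maps(2)[OF t x]])
  from has_derivative_compose[OF deriv_isotopy(2)[OF t x] this]
  show ?thesis unfolding pulled_ham_def fst_conv snd_conv by (rule has_derivative_lin2_cong) auto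
qed

text \<open>\<open>hamiltonian_of\<close> speaks of each time separately. Joint continuity is
  obtained by integrating the space derivative along radii, since it is built from the jointly
  continuous \<open>V\<close>, \<open>W1\<close> and \<open>W2\<close>.\<close>

lemma cont_pulled_ham: "continuous_on ({0..1} \<times> Disk) pulled_ham"
proof -
  define J where "J p = integral {0..1} (\<lambda>s. (\<i> * V (fst p, s *\<^sub>R snd p)) \<bullet>
     lin2 (W1 (fst p, s *\<^sub>R snd p)) (W2 (fst p, s *\<^sub>R snd p)) (snd p))" for p :: "real \<times> complex"
  have c: "continuous_on (({0..1} \<times> Disk) \<times> {0..1}) (\<lambda>q. f (fst (fst q), snd q *\<^sub>R snd (fst q)))"
    if "continuous_on ({0..1} \<times> Disk) f" for f :: "real \<times> complex \<Rightarrow> complex"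
    by (rule continuous_on_compose2[OF that])
      (auto intro!: continuous_intros simp: Disk_iff mult_le_one)
  have J: "continuous_on ({0..1} \<times> Disk) J"
    unfolding J_def cbox_interval[symmetric]
    by (rule integral_continuous_on_param, simp only: case_prod_beta' cbox_interval)
      (intro continuous_intros c cont_isotopy)
  have FTC: "J (t, x) = pulled_ham (t, x) - pulled_ham (t, 0)" if t: "t \<in> {0..1}" and x: "x \<in> Disk" for t x
  proof -
    have "((\<lambda>s. (\<i> * V (t, s *\<^sub>R x)) \<bullet> lin2 (W1 (t, s *\<^sub>R x)) (W2 (t, s *\<^sub>R x)) x) has_integral
       pulled_ham (t, 1 *\<^sub>R x) - pulled_ham (t, 0 *\<^sub>R x)) {0..1}"
    proof (rule fundamental_theorem_of_calculus_interior)
      have gc: "continuous_on Disk (g t)" by (rule Symp_image(2)[OF Symp[OF t]])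
      have Hc: "continuous_on Disk (H t)" using C1_H[OF t] by (simp add: C1_disk_def)
      have "continuous_on Disk (\<lambda>x. pulled_ham (t, x))"
        unfolding pulled_ham_def by (auto intro!: continuous_on_compose2[OF Hc] gc g_maps t)
      then show "continuous_on {0..1} (\<lambda>s. pulled_ham (t, s *\<^sub>R x))"
        by (rule continuous_on_compose2) (use x in \<open>auto intro!: continuous_intros simp: Disk_iff mult_le_one\<close>)
      fix s :: real assume s: "s \<in> {0<..<1}"
      have "s * cmod x \<le> s" using s x by (intro mult_left_le) (auto simp: Disk_iff)
      also have "s < 1" using s by simp
      finally have "s *\<^sub>R x \<in> ball 0 1" using s by simp
      note hd = pulled_ham_deriv[OF t this]
      have "((\<lambda>s. s *\<^sub>R x) has_vector_derivative x) (at s)"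
        by (auto intro!: derivative_eq_intros)
      from vector_derivative_diff_chain_within[OF this has_derivative_at_withinI[OF hd]]
      show "((\<lambda>s. pulled_ham (t, s *\<^sub>R x)) has_vector_derivative
         (\<i> * V (t, s *\<^sub>R x)) \<bullet> lin2 (W1 (t, s *\<^sub>R x)) (W2 (t, s *\<^sub>R x)) x) (at s)"
        by (simp add: o_def lin2_inner)
    qed simp
    then show ?thesis by (simp add: J_def integral_unique)
  qed
  \<comment> \<open>The unknown value at the centre is fixed by the boundary: \<open>g t\<close>
    keeps the point 1 on the circle, where \<open>H t\<close> vanishes, so
    \<open>pulled_ham (t, 0) = - J (t, 1)\<close>.\<close>
  have "pulled_ham (t, 1) = 0" if "t \<in> {0..1}" for t
    using H_boundary[OF that Symp_image(5)[OF Symp[OF that], of 1]] by (simp add: pulled_ham_def)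
  then have eq: "J p - J (fst p, 1) = pulled_ham p" if "p \<in> {0..1} \<times> Disk" for p
    using that FTC[of "fst p" "snd p"] FTC[of "fst p" 1] by (auto simp: Disk_iff)
  have "continuous_on ({0..1} \<times> Disk) (\<lambda>p. J p - J (fst p, 1))"
    by (intro continuous_intros J continuous_on_compose2[OF J]) (auto simp: Disk_iff)
  then show ?thesis by (rule continuous_on_eq) (rule eq)
qed

text \<open>The pullback by \<open>g t\<close> of \<open>H t + \<eta>(X)\<close>, the function whose
  differential is the Lie derivative of \<eta> along the velocity field \<open>X\<close>.\<close>

definition action_density :: "real \<times> complex \<Rightarrow> real" where
  "action_density p = pulled_ham p + \<eta> (g (fst p) (snd p)) \<bullet> V p"

definition action :: "complex \<Rightarrow> real" where
  "action x = integral {0..1} (\<lambda>t. action_density (t, x))"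

lemma cont_eta_g: "continuous_on ({0..1} \<times> Disk) (\<lambda>p. \<eta> (g (fst p) (snd p)))"
  "continuous_on ({0..1} \<times> Disk) (\<lambda>p. e1 (g (fst p) (snd p)))" "continuous_on ({0..1} \<times> Disk) (\<lambda>p. e2 (g (fst p) (snd p)))"
proof -
  have e: "continuous_on Disk \<eta>" "continuous_on Disk e1" "continuous_on Disk e2"
    using eta by (auto simp: C1_disk_def)
  show "continuous_on ({0..1} \<times> Disk) (\<lambda>p. \<eta> (g (fst p) (snd p)))"
    "continuous_on ({0..1} \<times> Disk) (\<lambda>p. e1 (g (fst p) (snd p)))" "continuous_on ({0..1} \<times> Disk) (\<lambda>p. e2 (g (fst p) (snd p)))"
    by (rule continuous_on_compose2[OF _ cont_isotopy(1)], rule e, use g_maps in auto)+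
qed

lemma cont_action_density: "continuous_on ({0..1} \<times> Disk) action_density"
  unfolding action_density_def by (intro continuous_intros cont_pulled_ham cont_eta_g cont_isotopy)

text \<open>After the integrals are exchanged, every time contributes the integral of
  \<open>H t\<close> twice: from the pulled-back Hamiltonian by area invariance, and from
  \<open>\<eta>(X)\<close> by \<open>integral_eta_V\<close>.\<close>

lemma integral_action: "integral Disk action = 2 * R_val H"
proof -
  have "integral Disk action = integral {0..1} (\<lambda>t. integral Disk (\<lambda>x. action_density (t, x)))"
    unfolding action_def by (rule integral_swap_compact[symmetric, OF compact_Icc compact_Disk cont_action_density])
  also have "\<dots> = integral {0..1} (\<lambda>t. 2 * integral Disk (H t))"
  proof (rule integral_cong)
    fix t :: real assume t: "t \<in> {0..1}"
    have "integral Disk (\<lambda>x. action_density (t, x)) = integral Disk (\<lambda>x. pulled_ham (t, x)) + integral Disk (\<lambda>x. \<eta> (g t x) \<bullet> V (t, x))"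
      unfolding action_density_def fst_conv snd_conv
      using cont_slice(1)[OF cont_pulled_ham t] cont_slice(1)[OF cont_eta_g(1) t] cont_slice(1)[OF cont_isotopy(2) t]
      by (intro Henstock_Kurzweil_Integration.integral_add continuous_integrable_Disk continuous_intros) auto
    also have "integral Disk (\<lambda>x. pulled_ham (t, x)) = integral Disk (H t)"
      unfolding pulled_ham_def fst_conv snd_conv
      by (rule integral_Disk_Symp[OF Symp[OF t]]) (use C1_H[OF t] in \<open>simp add: C1_disk_def\<close>)
    finally show "integral Disk (\<lambda>x. action_density (t, x)) = 2 * integral Disk (H t)"
      using integral_eta_V[OF t] by simp
  qed
  finally show ?thesis by (simp add: R_val_def)
qed

lemma W_0: assumes x: "x \<in> ball 0 1" shows "W1 (0, x) = 1" "W2 (0, x) = \<i>"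
proof -
  have "(g 0 has_derivative (\<lambda>h. h)) (at x)"
    by (rule has_derivative_transform_within_open[OF has_derivative_ident open_ball x]) (use g_0 ball_subset_Disk in auto)
  from has_derivative_unique[OF this deriv_isotopy(2)[OF _ x]]
  have "(\<lambda>h. h) = lin2 (W1 (0, x)) (W2 (0, x))" by simp
  from fun_cong[OF this, of 1] fun_cong[OF this, of \<i>]
  show "W1 (0, x) = 1" "W2 (0, x) = \<i>" by simp_all
qed

text \<open>The integrand is the space derivative of \<open>action_density\<close> along a direction \<open>W\<close>;
  by \<open>d\<eta> = \<omega>\<close> it is the time derivative of the pulled-back form \<open>g\<^sub>t\<^sup>*\<eta>\<close>
  (Cartan's formula).\<close>
lemma cartan:
  assumes x: "x \<in> ball 0 1"
    and dW: "\<And>t. t \<in> {0..1} \<Longrightarrow> ((\<lambda>s. W (s, x)) has_vector_derivative V' (t, x)) (at t within {0..1})"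
  shows "integral {0..1} (\<lambda>t. (\<i> * V (t, x)) \<bullet> W (t, x) + (lin2 (e1 (g t x)) (e2 (g t x)) (W (t, x)) \<bullet> V (t, x) + \<eta> (g t x) \<bullet> V' (t, x)))
     = \<eta> (g 1 x) \<bullet> W (1, x) - \<eta> (g 0 x) \<bullet> W (0, x)"
proof (rule integral_unique, rule fundamental_theorem_of_calculus)
  fix t :: real assume t: "t \<in> {0..1}"
  have "(\<eta> has_derivative lin2 (e1 (g t x)) (e2 (g t x))) (at (g t x))"
    using eta g_maps(2)[OF t x] by (simp add: C1_disk_def)
  from vector_derivative_diff_chain_within[OF deriv_isotopy(1)[OF t ball_subset_Disk[OF x]] has_derivative_at_withinI[OF this]]
  have "((\<lambda>t. \<eta> (g t x)) has_vector_derivative lin2 (e1 (g t x)) (e2 (g t x)) (V (t, x))) (at t within {0..1})"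
    by (simp add: o_def)
  from bounded_bilinear.has_vector_derivative[OF bounded_bilinear_inner this dW[OF t]]
  have 1: "((\<lambda>t. \<eta> (g t x) \<bullet> W (t, x)) has_vector_derivative
     \<eta> (g t x) \<bullet> V' (t, x) + lin2 (e1 (g t x)) (e2 (g t x)) (V (t, x)) \<bullet> W (t, x)) (at t within {0..1})" .
  \<comment> \<open>The antisymmetric part of the derivative of \<eta> is \<omega>: exchanging
    \<open>V\<close> and \<open>W\<close> costs
    \<open>\<omega>(V, W) = (\<i> * V) \<bullet> W\<close>.\<close>
  have "Im (e1 (g t x)) = 1 + Re (e2 (g t x))" using d_eta[OF g_maps(2)[OF t x]] by simp
  then have "lin2 (e1 (g t x)) (e2 (g t x)) (V (t, x)) \<bullet> W (t, x) =
    (\<i> * V (t, x)) \<bullet> W (t, x) + lin2 (e1 (g t x)) (e2 (g t x)) (W (t, x)) \<bullet> V (t, x)"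
    by (simp add: lin2_def inner_complex_def algebra_simps)
  with 1 show "((\<lambda>t. \<eta> (g t x) \<bullet> W (t, x)) has_vector_derivative
    (\<i> * V (t, x)) \<bullet> W (t, x) + (lin2 (e1 (g t x)) (e2 (g t x)) (W (t, x)) \<bullet> V (t, x) + \<eta> (g t x) \<bullet> V' (t, x))) (at t within {0..1})"
    by (simp add: ac_simps)
qed simp

lemma action_density_deriv:
  assumes t: "t \<in> {0..1}" and x: "x \<in> ball 0 1"
  shows "((\<lambda>x. action_density (t, x)) has_derivative lin2
     ((\<i> * V (t, x)) \<bullet> W1 (t, x) + (lin2 (e1 (g t x)) (e2 (g t x)) (W1 (t, x)) \<bullet> V (t, x) + \<eta> (g t x) \<bullet> V1 (t, x)))
     ((\<i> * V (t, x)) \<bullet> W2 (t, x) + (lin2 (e1 (g t x)) (e2 (g t x)) (W2 (t, x)) \<bullet> V (t, x) + \<eta> (g t x) \<bullet> V2 (t, x)))) (at x)"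
proof -
  have "(\<eta> has_derivative lin2 (e1 (g t x)) (e2 (g t x))) (at (g t x))"
    using eta g_maps(2)[OF t x] by (simp add: C1_disk_def)
  from has_derivative_add[OF pulled_ham_deriv[OF t x]
      has_derivative_inner[OF has_derivative_compose[OF deriv_isotopy(2)[OF t x] this] deriv_isotopy(3)[OF t x]]]
  show ?thesis unfolding action_density_def fst_conv snd_conv by (rule has_derivative_lin2_cong) auto
qed

text \<open>Differentiating under the time integral produces the integrand of \<open>cartan\<close>
  for the directions \<open>W1\<close> and \<open>W2\<close>. So the action is a primitive of the
  pullback of \<eta> by \<open>g 1\<close> minus \<eta>.\<close>

lemma C1_action: "C1_disk action (\<lambda>x. \<eta> (g 1 x) \<bullet> W1 (1, x) - \<eta> x \<bullet> 1) (\<lambda>x. \<eta> (g 1 x) \<bullet> W2 (1, x) - \<eta> x \<bullet> \<i>)"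
proof -
  have ec: "continuous_on Disk \<eta>" using eta by (simp add: C1_disk_def)
  have sw: "continuous_on (S \<times> {0..1}) (\<lambda>(x, t). f (t, x))" if "continuous_on ({0..1} \<times> Disk) f" "S \<subseteq> Disk" for f :: "real \<times> complex \<Rightarrow> real" and S
    unfolding case_prod_beta' by (rule continuous_on_compose2[OF that(1)]) (use that in \<open>auto intro!: continuous_intros\<close>)
  have 1: "(1::real) \<in> {0..1}" by simp
  note c1 = cont_slice(1)[OF cont_eta_g(1) 1] cont_slice(1)[OF cont_isotopy(3) 1] cont_slice(1)[OF cont_isotopy(4) 1]
  show ?thesis
    unfolding C1_disk_def
  proof (intro conjI ballI)
    show "continuous_on Disk action"
      unfolding action_def using integral_continuous_on_param[of Disk 0 1 "\<lambda>x t. action_density (t, x)"] sw[OF cont_action_density] by simp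
    show "continuous_on Disk (\<lambda>x. \<eta> (g 1 x) \<bullet> W1 (1, x) - \<eta> x \<bullet> 1)" "continuous_on Disk (\<lambda>x. \<eta> (g 1 x) \<bullet> W2 (1, x) - \<eta> x \<bullet> \<i>)"
      using c1 by (auto intro!: continuous_intros ec)
    fix x :: complex assume x: "x \<in> ball 0 1"
    have B: "ball 0 1 \<subseteq> Disk" by (simp add: Disk_def)
    let ?f = "\<lambda>W V' x t. (\<i> * V (t, x)) \<bullet> W (t, x) + (lin2 (e1 (g t x)) (e2 (g t x)) (W (t, x)) \<bullet> V (t, x) + \<eta> (g t x) \<bullet> V' (t, x))"
    have cc: "continuous_on (ball 0 1 \<times> {0..1}) (\<lambda>(x, t). ?f W V' x t)"
      if "continuous_on ({0..1} \<times> Disk) W" "continuous_on ({0..1} \<times> Disk) V'" for W V'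
    proof -
      have "continuous_on ({0..1} \<times> Disk) (\<lambda>p. (\<i> * V p) \<bullet> W p + (lin2 (e1 (g (fst p) (snd p))) (e2 (g (fst p) (snd p))) (W p) \<bullet> V p
         + \<eta> (g (fst p) (snd p)) \<bullet> V' p))"
        by (intro continuous_intros cont_eta_g cont_isotopy that)
      from sw[OF this B] show ?thesis by simp
    qed
    have "(action has_derivative lin2 (integral {0..1} (?f W1 V1 x)) (integral {0..1} (?f W2 V2 x))) (at x)"
      unfolding action_def
    proof (rule has_derivative_integral_lin2[where U = "ball 0 1"])
      show "continuous_on {0..1} (\<lambda>t. action_density (t, y))" if "y \<in> ball 0 1" for y
        by (rule cont_slice(2)[OF cont_action_density ball_subset_Disk[OF that]])
    qed (rule action_density_deriv cc cont_isotopy open_ball convex_ball x; assumption?)+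
    also have "integral {0..1} (?f W1 V1 x) = \<eta> (g 1 x) \<bullet> W1 (1, x) - \<eta> x \<bullet> 1"
    proof (subst cartan[OF x])
      show "((\<lambda>s. W1 (s, x)) has_vector_derivative V1 (t, x)) (at t within {0..1})" if "t \<in> {0..1}" for t
        by (rule deriv_isotopy(4)[OF that x])
    qed (simp only: W_0[OF x] g_0[OF ball_subset_Disk[OF x]])
    also have "integral {0..1} (?f W2 V2 x) = \<eta> (g 1 x) \<bullet> W2 (1, x) - \<eta> x \<bullet> \<i>"
    proof (subst cartan[OF x])
      show "((\<lambda>s. W2 (s, x)) has_vector_derivative V2 (t, x)) (at t within {0..1})" if "t \<in> {0..1}" for t
        by (rule deriv_isotopy(5)[OF that x])
    qed (simp only: W_0[OF x] g_0[OF ball_subset_Disk[OF x]])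
    finally show "(action has_derivative lin2 (\<eta> (g 1 x) \<bullet> W1 (1, x) - \<eta> x \<bullet> 1) (\<eta> (g 1 x) \<bullet> W2 (1, x) - \<eta> x \<bullet> \<i>)) (at x)" .
  qed
qed

end

section \<open>Translation numbers\<close>

lemma real_antiderivative:
  fixes f :: "real \<Rightarrow> real"
  assumes f: "continuous_on UNIV f"
  obtains A where "\<And>x. (A has_real_derivative f x) (at x)"
proof -
  \<comment> \<open>This is the oriented integral from 0 to \<open>x\<close>; the base point lies to
    the left of both, so the sign of \<open>x\<close> needs no case distinction.\<close>
  define A where "A x = integral {-(\<bar>x\<bar>+1)..x} f - integral {-(\<bar>x\<bar>+1)..0} f" for x
  have i: "f integrable_on {x..y}" for x y
    by (intro integrable_continuous_real continuous_on_subset[OF f]) auto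
  have A: "A x = integral {-N..x} f - integral {-N..0} f" if "\<bar>x\<bar> + 1 \<le> N" for x N
  proof -
    have "integral {-N..y} f = integral {-N..-(\<bar>x\<bar>+1)} f + integral {-(\<bar>x\<bar>+1)..y} f" if "y \<in> {0, x}" for y
      by (rule Henstock_Kurzweil_Integration.integral_combine[symmetric]) (use that \<open>\<bar>x\<bar> + 1 \<le> N\<close> i in auto)
    from this[of 0] this[of x] show ?thesis by (simp add: A_def)
  qed
  have "(A has_real_derivative f x) (at x)" for x
  proof -
    define N where "N = \<bar>x\<bar> + 2"
    have x: "x \<in> {-N+1<..<N-1}" by (auto simp: N_def)
    have "((\<lambda>u. integral {-N..u} f) has_vector_derivative f x) (at x within {-N..N})"
      by (rule integral_has_vector_derivative) (use x in \<open>auto intro: continuous_on_subset[OF f]\<close>)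
    moreover have "at x within {-N..N} = at x"
      by (rule at_within_interior) (use x in auto)
    ultimately have "((\<lambda>u. integral {-N..u} f - integral {-N..0} f) has_real_derivative f x) (at x)"
      by (auto simp: has_real_derivative_iff_has_vector_derivative intro!: derivative_eq_intros)
    then show ?thesis
      by (rule has_field_derivative_transform_within_open[OF _ open_greaterThanLessThan x]) (rule A[symmetric], auto)
  qed
  then show ?thesis by (rule that)
qed

lemma periodic_of_int:
  fixes f :: "real \<Rightarrow> 'a"
  assumes "\<And>x. f (x + p) = f x"
  shows "f (x + of_int k * p) = f x"
proof (induction k rule: int_induct[where k = 0])
  case (step1 i)
  then show ?case using assms[of "x + of_int i * p"] by (simp add: algebra_simps)
next
  case (step2 i)
  then show ?case using assms[of "x + of_int (i - 1) * p"] by (simp add: algebra_simps)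
qed simp

lemma periodic_reduce:
  fixes x p :: real
  assumes "0 < p"
  obtains y and m :: int where "y \<in> {0..p}" "x = y + of_int m * p"
proof
  show "x = (x - of_int \<lfloor>x / p\<rfloor> * p) + of_int \<lfloor>x / p\<rfloor> * p" by simp
  show "x - of_int \<lfloor>x / p\<rfloor> * p \<in> {0..p}"
    using floor_divide_lower[OF assms, of x] floor_divide_upper[OF assms, of x] by (simp add: algebra_simps)
qed

lemma periodic_bounded:
  fixes f :: "real \<Rightarrow> real"
  assumes f: "continuous_on UNIV f" and per: "\<And>x. f (x + p) = f x" and p: "0 < p"
  obtains M where "\<And>x. \<bar>f x\<bar> \<le> M"
proof -
  have "compact (f ` {0..p})"
    by (intro compact_continuous_image continuous_on_subset[OF f]) auto
  then obtain M where "\<forall>y\<in>f ` {0..p}. norm y \<le> M"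
    using compact_imp_bounded bounded_iff by metis
  then have M: "\<And>x. x \<in> {0..p} \<Longrightarrow> \<bar>f x\<bar> \<le> M" by simp
  have "\<bar>f x\<bar> \<le> M" for x
    by (rule periodic_reduce[OF p, of x]) (simp add: periodic_of_int[of f, OF per] M)
  then show ?thesis by (rule that)
qed

text \<open>Comparing \<open>a (m * n)\<close> with both \<open>real m * a n\<close> and
  \<open>real n * a m\<close> shows that the quotients form a Cauchy sequence.\<close>

lemma quasi_additive_convergent:
  fixes a :: "nat \<Rightarrow> real"
  assumes a: "\<And>m n. \<bar>a (m + n) - a m - a n\<bar> \<le> C"
  shows "convergent (\<lambda>n. a n / real n)"
proof -
  have C: "0 \<le> C" using a[of 0 0] by simp
  \<comment> \<open>The summand 1 in the factor covers \<open>k = 0\<close>, where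
    \<open>\<bar>a 0\<bar> \<le> C\<close> is what quasi-additivity gives.\<close>
  have mul: "\<bar>a (k * n) - real k * a n\<bar> \<le> (real k + 1) * C" for k n
  proof (induction k)
    case 0 show ?case using a[of 0 0] by simp
  next
    case (Suc k) then show ?case using a[of n "k * n"] by (simp add: algebra_simps)
  qed
  have mul': "\<bar>a (m * n) / (real m * real n) - a n / real n\<bar> \<le> 2 * C / real n" if "0 < m" "0 < n" for m n
  proof -
    have "a (m * n) / (real m * real n) - a n / real n = (a (m * n) - real m * a n) / (real m * real n)"
      using that by (simp add: field_simps)
    also have "\<bar>\<dots>\<bar> \<le> ((real m + 1) * C) / (real m * real n)"
      using mul[of m n] that by (simp add: abs_mult divide_right_mono)
    also have "\<dots> \<le> (2 * real m * C) / (real m * real n)"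
      using that C by (intro divide_right_mono mult_right_mono) auto
    also have "\<dots> = 2 * C / real n" using that by (simp add: field_simps)
    finally show ?thesis .
  qed
  have d: "\<bar>a m / real m - a n / real n\<bar> \<le> 2 * C / real m + 2 * C / real n" if "0 < m" "0 < n" for m n
    using mul'[OF that] mul'[OF that(2,1)] by (simp add: mult.commute)
  have "Cauchy (\<lambda>n. a n / real n)"
  proof (rule metric_CauchyI)
    fix e :: real assume e: "0 < e"
    obtain N :: nat where N: "4 * C / e < real N" using reals_Archimedean2 by blast
    have b: "2 * C / real n < e / 2" if "Suc N \<le> n" for n
    proof -
      have "4 * C < e * real n" using N that e by (smt (verit) of_nat_le_iff le_simps(3) less_imp_le_nat pos_divide_less_eq mult.commute)
      then show ?thesis using that by (simp add: field_simps)
    qed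
    have "dist (a m / real m) (a n / real n) < e" if "Suc N \<le> m" "Suc N \<le> n" for m n
      using d[of m n] b[OF that(1)] b[OF that(2)] that by (simp add: dist_real_def)
    then show "\<exists>M. \<forall>m\<ge>M. \<forall>n\<ge>M. dist (a m / real m) (a n / real n) < e" by blast
  qed
  then show ?thesis by (simp add: Cauchy_convergent_iff)
qed

section \<open>Monotone maps of degree one and their translation numbers\<close>

locale degree_one_mono =
  fixes F :: "real \<Rightarrow> real"
  assumes mono: "mono F" and degree: "F (x + 2 * pi) = F x + 2 * pi"
begin

lemma funpow_degree: "(F ^^ n) (x + 2 * pi) = (F ^^ n) x + 2 * pi"
  by (induction n) (simp_all add: degree)

text \<open>The displacement of \<open>F ^^ n\<close> is periodic, so \<open>x\<close> may be moved
  to a point \<open>y\<close> of \<open>{0..2*pi}\<close>. Monotonicity then places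
  \<open>(F ^^ n) y\<close> between \<open>(F ^^ n) 0\<close> and
  \<open>(F ^^ n) 0 + 2 * pi\<close>.\<close>

lemma funpow_deviation: "\<bar>(F ^^ n) x - x - (F ^^ n) 0\<bar> \<le> 2 * pi"
proof -
  have "(F ^^ n) (y + 2 * pi) - (y + 2 * pi) = (F ^^ n) y - y" for y by (simp add: funpow_degree)
  note per = periodic_of_int[of "\<lambda>y. (F ^^ n) y - y", OF this]
  obtain y m where y: "y \<in> {0..2*pi}" "x = y + of_int m * (2 * pi)"
    by (rule periodic_reduce[of "2 * pi" x]) auto
  have "(F ^^ n) 0 \<le> (F ^^ n) y" "(F ^^ n) y \<le> (F ^^ n) (0 + 2 * pi)"
    using y funpow_mono[OF mono] by auto
  then have "\<bar>((F ^^ n) y - y) - (F ^^ n) 0\<bar> \<le> 2 * pi"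
    using y unfolding funpow_degree by auto
  then show ?thesis unfolding y(2) using per[of y m] by simp
qed

lemma transl_convergent: "convergent (\<lambda>n. (F ^^ n) 0 / real n)"
proof (rule quasi_additive_convergent)
  show "\<bar>(F ^^ (m + n)) 0 - (F ^^ m) 0 - (F ^^ n) 0\<bar> \<le> 2 * pi" for m n
    using funpow_deviation[of m "(F ^^ n) 0"] by (simp add: funpow_add)
qed

end

section \<open>The isotopy on the boundary circle\<close>

context hamiltonian_isotopy
begin

definition angular_velocity :: "real \<Rightarrow> real \<Rightarrow> real" where
  "angular_velocity \<theta> t = Im (cnj (g t (cis \<theta>)) * V (t, cis \<theta>))"

text \<open>The angle of the point starting at \<open>cis \<theta>\<close>, followed continuously in
  time. At time 1 it is the lift of \<open>g 1\<close> singled out by the isotopy.\<close>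

definition lift :: "real \<Rightarrow> real \<Rightarrow> real" where
  "lift \<theta> t = \<theta> + integral {0..t} (angular_velocity \<theta>)"

lemma cis_Disk[simp]: "cis \<theta> \<in> Disk" by (simp add: Disk_iff)

lemma cont_angular_velocity: "continuous_on {0..1} (angular_velocity \<theta>)"
  unfolding angular_velocity_def using cont_slice(2)[OF cont_isotopy(1) cis_Disk] cont_slice(2)[OF cont_isotopy(2) cis_Disk]
  by (auto intro!: continuous_intros)

text \<open>Boundary points stay on the unit circle; differentiating the constant squared norm makes
  the velocity orthogonal to the position.\<close>

lemma V_boundary:
  assumes t: "t \<in> {0..1}"
  shows "V (t, cis \<theta>) = \<i> * of_real (angular_velocity \<theta> t) * g t (cis \<theta>)"
proof -
  let ?c = "g t (cis \<theta>)" and ?v = "V (t, cis \<theta>)"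
  have n: "cmod (g s (cis \<theta>)) = 1" if "s \<in> {0..1}" for s
    by (rule Symp_image(5)[OF Symp[OF that]]) simp
  have "((\<lambda>s. g s (cis \<theta>) \<bullet> g s (cis \<theta>)) has_vector_derivative ?c \<bullet> ?v + ?v \<bullet> ?c) (at t within {0..1})"
    by (rule bounded_bilinear.has_vector_derivative[OF bounded_bilinear_inner]; rule deriv_isotopy(1)[OF t cis_Disk])
  moreover have "((\<lambda>s. g s (cis \<theta>) \<bullet> g s (cis \<theta>)) has_vector_derivative 0) (at t within {0..1})"
    by (rule has_vector_derivative_transform[OF t _ has_vector_derivative_const[of 1]]) (simp add: n dot_square_norm)
  ultimately have "?c \<bullet> ?v + ?v \<bullet> ?c = 0"
    using t vector_derivative_unique_within_closed_interval[of 0 1 t] by auto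
  then have "Re (cnj ?c * ?v) = 0" by (simp add: inner_complex_def algebra_simps)
  then have "cnj ?c * ?v = \<i> * of_real (angular_velocity \<theta> t)" by (simp add: complex_eq_iff angular_velocity_def)
  then have "?c * cnj ?c * ?v = \<i> * of_real (angular_velocity \<theta> t) * ?c" by (simp add: ac_simps)
  then show ?thesis using n[OF t] by (simp add: complex_norm_square[symmetric])
qed

lemma lift_deriv:
  "t \<in> {0..1} \<Longrightarrow> (lift \<theta> has_vector_derivative angular_velocity \<theta> t) (at t within {0..1})"
  unfolding lift_def using integral_has_vector_derivative[OF cont_angular_velocity, of t \<theta>]
  by (auto intro!: derivative_eq_intros)

text \<open>The product \<open>cis (- lift \<theta> s) * g s (cis \<theta>)\<close> has zero time
  derivative by \<open>V_boundary\<close>, and it equals 1 at time 0.\<close>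

lemma cis_lift:
  assumes t: "t \<in> {0..1}"
  shows "g t (cis \<theta>) = cis (lift \<theta> t)"
proof -
  have "((\<lambda>s. cis (- lift \<theta> s) * g s (cis \<theta>)) has_vector_derivative 0) (at s within {0..1})" if s: "s \<in> {0..1}" for s
  proof -
    have "((\<lambda>s. cis (- lift \<theta> s)) has_vector_derivative (- angular_velocity \<theta> s) *\<^sub>R (\<i> * cis (- lift \<theta> s))) (at s within {0..1})"
      using lift_deriv[OF s, of \<theta>] unfolding has_vector_derivative_def
      by (auto intro!: derivative_eq_intros simp: fun_eq_iff)
    from has_vector_derivative_mult[OF this deriv_isotopy(1)[OF s cis_Disk[of \<theta>]]]
    show ?thesis by (simp add: V_boundary[OF s] scaleR_conv_of_real)
  qed
  from has_vector_derivative_zero_constant[OF convex_closed_interval this]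
  obtain c where c: "\<And>s. s \<in> {0..1} \<Longrightarrow> cis (- lift \<theta> s) * g s (cis \<theta>) = c" by auto
  have "c = 1" using c[of 0] by (simp add: lift_def g_0 cis_mult)
  then have "cis (lift \<theta> t) * (cis (- lift \<theta> t) * g t (cis \<theta>)) = cis (lift \<theta> t)" using c[OF t] by simp
  then show ?thesis by (simp add: cis_mult mult.assoc[symmetric])
qed

lemma lift_periodic: "lift (\<theta> + 2 * pi) t = lift \<theta> t + 2 * pi"
proof -
  have "cis (\<theta> + 2 * pi) = cis \<theta>" by (simp add: complex_eq_iff)
  then show ?thesis by (simp add: lift_def angular_velocity_def[abs_def])
qed

lemma cont_lift: "continuous_on UNIV (\<lambda>\<theta>. lift \<theta> 1)"
proof -
  have "continuous_on (UNIV \<times> cbox 0 1) (\<lambda>(\<theta>, t). angular_velocity \<theta> t)"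
    unfolding angular_velocity_def case_prod_beta'
    by (intro continuous_intros continuous_on_compose2[OF cont_isotopy(2)] continuous_on_compose2[OF cont_isotopy(1), where f = "\<lambda>p. (snd p, cis (fst p))", simplified])
      auto
  from integral_continuous_on_param[OF this]
  show ?thesis unfolding lift_def by (auto intro!: continuous_intros)
qed

text \<open>A continuous injective function on the line is strictly monotone, and growth by
  \<open>2 * pi\<close> per period rules out a decreasing one. For injectivity, equal values force
  the arguments to differ by a multiple of \<open>2 * pi\<close>, and periodicity of the
  displacement makes that multiple zero.\<close>

lemma degree_one_lift: "degree_one_mono (\<lambda>\<theta>. lift \<theta> 1)"
proof
  let ?F = "\<lambda>\<theta>. lift \<theta> 1"
  have one: "(1::real) \<in> {0..1}" by simp
  have "inj ?F"
  proof (rule injI)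
    fix x y assume xy: "?F x = ?F y"
    then have "g 1 (cis x) = g 1 (cis y)" by (simp add: cis_lift)
    then have "cis x = cis y"
      using Symp_image(1)[OF Symp[OF one]] cis_Disk by (auto simp: bij_betw_def dest: inj_onD)
    then have "sin x = sin y \<and> cos x = cos y" by (simp add: complex_eq_iff)
    then obtain n :: int where n: "x = y + 2 * pi * n" using sin_cos_eq_iff by blast
    have "lift (z + 2 * pi) 1 - (z + 2 * pi) = lift z 1 - z" for z by (simp add: lift_periodic)
    from periodic_of_int[of "\<lambda>z. lift z 1 - z", OF this, of y n]
    have "?F x - x = ?F y - y" by (simp add: n mult.commute)
    with xy show "x = y" by simp
  qed
  then have "strict_mono ?F \<or> strict_antimono_on UNIV ?F"
    using injective_eq_monotone_map[OF is_interval_univ cont_lift] by blast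
  moreover have "\<not> strict_antimono_on UNIV ?F"
  proof
    assume "strict_antimono_on UNIV ?F"
    then have "?F (0 + 2 * pi) < ?F 0"
      by (rule monotone_onD) auto
    then show False unfolding lift_periodic using pi_gt_zero by linarith
  qed
  ultimately show "mono ?F" using strict_mono_mono by blast
  show "?F (x + 2 * pi) = ?F x + 2 * pi" for x by (rule lift_periodic)
qed

text \<open>On the circle \<open>H t\<close> vanishes, so only \<open>\<eta>(X)\<close> remains, and
  this is the time derivative of \<open>A (lift \<theta> t)\<close>.\<close>

lemma action_boundary:
  assumes A: "\<And>x. (A has_real_derivative \<eta> (cis x) \<bullet> (\<i> * cis x)) (at x)"
  shows "action (cis \<theta>) = A (lift \<theta> 1) - A \<theta>"
proof -
  have "((\<lambda>t. action_density (t, cis \<theta>)) has_integral A (lift \<theta> 1) - A (lift \<theta> 0)) {0..1}"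
  proof (rule fundamental_theorem_of_calculus)
    fix t :: real assume t: "t \<in> {0..1}"
    have "pulled_ham (t, cis \<theta>) = 0"
      unfolding pulled_ham_def by (simp, rule H_boundary[OF t Symp_image(5)[OF Symp[OF t]]]) simp
    then have "action_density (t, cis \<theta>) = angular_velocity \<theta> t * (\<eta> (cis (lift \<theta> t)) \<bullet> (\<i> * cis (lift \<theta> t)))"
      by (simp add: action_density_def V_boundary[OF t] cis_lift[OF t] inner_complex_def algebra_simps)
    moreover have "((\<lambda>t. A (lift \<theta> t)) has_vector_derivative angular_velocity \<theta> t * (\<eta> (cis (lift \<theta> t)) \<bullet> (\<i> * cis (lift \<theta> t)))) (at t within {0..1})"
    proof -
      have "(A has_derivative (*) (\<eta> (cis (lift \<theta> t)) \<bullet> (\<i> * cis (lift \<theta> t)))) (at (lift \<theta> t))"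
        using A by (simp add: has_field_derivative_def)
      from vector_derivative_diff_chain_within[OF lift_deriv[OF t] has_derivative_at_withinI[OF this]]
      show ?thesis by (simp add: o_def mult.commute)
    qed
    ultimately show "((\<lambda>t. A (lift \<theta> t)) has_vector_derivative action_density (t, cis \<theta>)) (at t within {0..1})" by simp
  qed simp
  then show ?thesis by (simp add: action_def integral_unique lift_def)
qed

end

section \<open>Asymptotics of the quasi-morphism\<close>

context hamiltonian_isotopy
begin

lemma cont_circle_form: "continuous_on S (\<lambda>x. \<eta> (cis x) \<bullet> (\<i> * cis x))"
proof -
  have "continuous_on Disk \<eta>" using eta by (simp add: C1_disk_def)
  then have "continuous_on S (\<lambda>x. \<eta> (cis x))"
    by (rule continuous_on_compose2) (auto intro!: continuous_intros)
  then show ?thesis by (intro continuous_intros)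
qed

text \<open>Green's theorem with the constant function 1 equates the circle integral of \<eta> with
  the area \<open>pi\<close> of the disk. Hence \<open>A\<close> grows by \<open>pi\<close> per
  turn, and \<open>A x - x / 2\<close> is periodic and bounded.\<close>

lemma circle_form_primitive:
  obtains A M where "\<And>x. (A has_real_derivative \<eta> (cis x) \<bullet> (\<i> * cis x)) (at x)"
    and "\<And>x. \<bar>A x - x / 2\<bar> \<le> M"
    and "integral {0..2*pi} (\<lambda>x. \<eta> (cis x) \<bullet> (\<i> * cis x)) = pi"
proof -
  let ?a = "\<lambda>x. \<eta> (cis x) \<bullet> (\<i> * cis x)"
  note ac = cont_circle_form
  obtain A where A: "\<And>x. (A has_real_derivative ?a x) (at x)"
    using real_antiderivative[OF ac] by blast
  have "C1_disk (\<lambda>_. 1::real) (\<lambda>_. 0) (\<lambda>_. 0)"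
    unfolding C1_disk_def by (auto intro!: continuous_intros has_derivative_lin2_cong[OF has_derivative_const])
  from green_Disk[OF this eta d_eta]
  have "integral {0..2*pi} ?a = integral Disk (\<lambda>_. 1)" by simp
  also have "\<dots> = measure lebesgue (cball 0 1 :: complex set)" 
    unfolding Disk_def by (rule lmeasure_integral[symmetric]) simp
  also have "\<dots> = pi" by (simp add: measure_completion content_cball unit_ball_vol_2)
  finally have total: "integral {0..2*pi} ?a = pi" .
  have "(?a has_integral A (2*pi) - A 0) {0..2*pi}"
    using A by (intro fundamental_theorem_of_calculus)
      (auto simp: has_real_derivative_iff_has_vector_derivative intro: has_vector_derivative_at_within)
  then have A0: "A (2*pi) - A 0 = pi" using total by (simp add: integral_unique)
  have "((\<lambda>x. A (x + 2*pi) - A x) has_real_derivative 0) (at x)" for x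
  proof -
    have "cis (x + 2*pi) = cis x" by (simp add: complex_eq_iff)
    then show ?thesis
      using DERIV_diff[OF DERIV_shift[THEN iffD1, OF A[of "x + 2*pi"]] A[of x]] by simp
  qed
  then have "A (x + 2*pi) - A x = A (0 + 2*pi) - A 0" for x
    by (intro DERIV_isconst_all[of "\<lambda>x. A (x + 2*pi) - A x"]) auto
  then have per: "A (x + 2*pi) - (x + 2*pi) / 2 = A x - x / 2" for x
    using A0 by (simp add: field_simps)
  have "continuous_on UNIV (\<lambda>x. A x - x / 2)"
    by (intro continuous_intros DERIV_continuous_on[OF has_field_derivative_at_within[OF A]]) simp
  from periodic_bounded[OF this per] obtain M where "\<And>x. \<bar>A x - x / 2\<bar> \<le> M" by auto
  with A total show ?thesis by (intro that)
qed

text \<open>The boundary values of the action telescope along an orbit. Their sum is half the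
  displacement of 0 up to an error bounded uniformly in \<theta> and \<open>n\<close>, and
  integration against a form of total mass \<open>pi\<close> yields the factor
  \<open>pi / 2\<close>.\<close>

lemma tau_funpow_asymptotics:
  assumes phi: "\<phi> \<in> Symp" and g_1: "\<And>x. x \<in> Disk \<Longrightarrow> g 1 x = \<phi> x"
  obtains C where "\<And>n. \<bar>tau \<eta> (\<phi> ^^ n) + 2 * real n * R_val H - pi / 2 * ((\<lambda>\<theta>. lift \<theta> 1) ^^ n) 0\<bar> \<le> C"
proof -
  let ?a = "\<lambda>x. \<eta> (cis x) \<bullet> (\<i> * cis x)" and ?F = "\<lambda>\<theta>. lift \<theta> 1"
  interpret F: degree_one_mono ?F by (rule degree_one_lift)
  obtain A M where A: "\<And>x. (A has_real_derivative ?a x) (at x)" and M: "\<And>x. \<bar>A x - x / 2\<bar> \<le> M"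
    and total: "integral {0..2*pi} ?a = pi" using circle_form_primitive by blast
  note ac = cont_circle_form
  have Ac: "continuous_on UNIV A"
    using A by (auto intro!: DERIV_continuous_on intro: has_field_derivative_at_within)
  have one: "(1::real) \<in> {0..1}" by simp
  have cis: "(\<phi> ^^ i) (cis \<theta>) = cis ((?F ^^ i) \<theta>)" for i \<theta>
    by (induction i) (simp_all add: g_1[symmetric] cis_lift)
  have p: "C1_disk \<phi> (\<lambda>x. W1 (1, x)) (\<lambda>x. W2 (1, x))"
  proof (rule C1_disk_cong[of "g 1"])
    show "C1_disk (g 1) (\<lambda>x. W1 (1, x)) (\<lambda>x. W2 (1, x))"
      unfolding C1_disk_def
      using Symp_image(2)[OF Symp[OF one]] cont_slice(1)[OF cont_isotopy(3) one] cont_slice(1)[OF cont_isotopy(4) one]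
        deriv_isotopy(2)[OF one] by blast
  qed (rule g_1)
  define a where "a n = (?F ^^ n) 0" for n
  \<comment> \<open>\<open>b n\<close> is the error made when the telescoped action is replaced by
    the constant \<open>a n / 2\<close>.\<close>
  define b where "b n \<theta> = A ((?F ^^ n) \<theta>) - A \<theta> - a n / 2" for n \<theta>
  have tau: "tau \<eta> (\<phi> ^^ n) = integral {0..2*pi} (\<lambda>\<theta>. (A ((?F ^^ n) \<theta>) - A \<theta>) * ?a \<theta>) - real n * (2 * R_val H)" for n
  proof -
    have "tau \<eta> (\<phi> ^^ n) = integral {0..2*pi} (\<lambda>\<theta>. (\<Sum>i<n. action ((\<phi> ^^ i) (cis \<theta>))) * ?a \<theta>) - real n * integral Disk action"
      by (rule tau_funpow[OF phi p eta d_eta C1_action]) (simp_all add: g_1 ball_subset_Disk)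
    also have "(\<lambda>\<theta>. (\<Sum>i<n. action ((\<phi> ^^ i) (cis \<theta>))) * ?a \<theta>) = (\<lambda>\<theta>. (A ((?F ^^ n) \<theta>) - A \<theta>) * ?a \<theta>)"
    proof
      fix \<theta>
      have "(\<Sum>i<n. action ((\<phi> ^^ i) (cis \<theta>))) = (\<Sum>i<n. A ((?F ^^ Suc i) \<theta>) - A ((?F ^^ i) \<theta>))"
        by (simp add: cis action_boundary[OF A])
      also have "\<dots> = A ((?F ^^ n) \<theta>) - A ((?F ^^ 0) \<theta>)" by (rule sum_lessThan_telescope)
      finally show "(\<Sum>i<n. action ((\<phi> ^^ i) (cis \<theta>))) * ?a \<theta> = (A ((?F ^^ n) \<theta>) - A \<theta>) * ?a \<theta>" by simp
    qed
    finally show ?thesis by (simp only: integral_action)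
  qed
  \<comment> \<open>Each of the two values of \<open>A\<close> costs \<open>M\<close> when replaced
    by half its argument, and half of the deviation bound \<open>2 * pi\<close> gives
    \<open>pi\<close>.\<close>
  have b: "\<bar>b n \<theta>\<bar> \<le> 2 * M + pi" for n \<theta>
  proof -
    have "\<bar>(?F ^^ n) \<theta> / 2 - \<theta> / 2 - a n / 2\<bar> \<le> pi"
      using F.funpow_deviation[of n \<theta>] by (simp add: a_def abs_le_iff field_simps)
    then show ?thesis using M[of \<theta>] M[of "(?F ^^ n) \<theta>"] by (auto simp: b_def abs_le_iff)
  qed
  obtain M' where M': "\<And>x. \<bar>?a x\<bar> \<le> M'"
  proof (rule periodic_bounded[OF ac])
    show "?a (x + 2*pi) = ?a x" for x
    proof -
      have "cis (x + 2*pi) = cis x" by (simp add: complex_eq_iff)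
      then show ?thesis by simp
    qed
  qed auto
  have Fc: "continuous_on UNIV (?F ^^ n)" for n
  proof (induction n)
    case (Suc n)
    have "continuous_on UNIV (\<lambda>\<theta>. ?F ((?F ^^ n) \<theta>))" by (rule continuous_on_compose2[OF cont_lift Suc]) simp
    then show ?case by (simp add: o_def)
  qed (simp add: id_def)
  have bc: "continuous_on S (b n)" for S n
    unfolding b_def by (intro continuous_intros continuous_on_subset[OF Ac] continuous_on_compose2[OF Ac continuous_on_subset[OF Fc]]) auto
  have "\<bar>tau \<eta> (\<phi> ^^ n) + 2 * real n * R_val H - pi / 2 * a n\<bar> \<le> (2 * M + pi) * M' * (2 * pi - 0)" for n
  proof -
    have "integral {0..2*pi} (\<lambda>\<theta>. (A ((?F ^^ n) \<theta>) - A \<theta>) * ?a \<theta>) = integral {0..2*pi} (\<lambda>\<theta>. b n \<theta> * ?a \<theta> + a n / 2 * ?a \<theta>)"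
      by (rule integral_cong) (simp add: b_def algebra_simps)
    also have "\<dots> = integral {0..2*pi} (\<lambda>\<theta>. b n \<theta> * ?a \<theta>) + a n / 2 * pi"
      using Henstock_Kurzweil_Integration.integral_add[of "\<lambda>\<theta>. b n \<theta> * ?a \<theta>" "{0..2*pi}" "\<lambda>\<theta>. a n / 2 * ?a \<theta>"]
      by (simp add: integrable_continuous_real continuous_on_mult bc ac total)
    finally have "tau \<eta> (\<phi> ^^ n) + 2 * real n * R_val H - pi / 2 * a n = integral {0..2*pi} (\<lambda>\<theta>. b n \<theta> * ?a \<theta>)"
      unfolding tau by simp
    also have "\<bar>\<dots>\<bar> \<le> (2 * M + pi) * M' * (2 * pi - 0)"
      unfolding real_norm_def[symmetric]
    proof (rule integral_bound)
      show "norm (b n \<theta> * ?a \<theta>) \<le> (2 * M + pi) * M'" for \<theta>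
        unfolding real_norm_def abs_mult by (intro mult_mono b M') (use b[of n \<theta>] in auto)
    qed (auto intro: continuous_on_mult bc ac)
    finally show ?thesis .
  qed
  then show ?thesis unfolding a_def by (rule that)
qed

end

section \<open>Comparison with an arbitrary lift\<close>

lemma lifts_differ_by_int:
  fixes F G :: "real \<Rightarrow> real"
  assumes F: "continuous_on UNIV F" and G: "continuous_on UNIV G" and eq: "\<And>x. cis (F x) = cis (G x)"
  obtains m :: int where "\<And>x. F x = G x + 2 * pi * of_int m"
proof -
  define d where "d x = (F x - G x) / (2 * pi)" for x
  have d: "\<exists>m::int. d x = of_int m" for x
  proof -
    have "sin (F x) = sin (G x) \<and> cos (F x) = cos (G x)" using eq[of x] by (simp add: complex_eq_iff)
    then obtain m :: int where "F x = G x + 2 * pi * m" using sin_cos_eq_iff by blast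
    then show ?thesis by (auto simp: d_def)
  qed
  \<comment> \<open>A continuous function on the line with integer values is constant, since
    distinct values are at distance at least 1.\<close>
  have "d constant_on UNIV"
  proof (rule continuous_discrete_range_constant)
    show "continuous_on UNIV d" unfolding d_def by (intro continuous_intros F G) simp
    fix x
    have "1 \<le> norm (d y - d x)" if "d y \<noteq> d x" for y
    proof -
      obtain i j :: int where ij: "d x = of_int i" "d y = of_int j" using d by meson
      then have "1 \<le> \<bar>j - i\<bar>" using that by auto
      then have "(1::real) \<le> of_int \<bar>j - i\<bar>" by linarith
      then show ?thesis by (simp add: ij)
    qed
    then show "\<exists>e>0. \<forall>y. y \<in> UNIV \<and> d y \<noteq> d x \<longrightarrow> e \<le> norm (d y - d x)"
      by (intro exI[of _ 1]) auto
  qed (rule connected_UNIV)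
  then obtain c where "\<And>x. d x = c" by (auto simp: constant_on_def)
  with d obtain m :: int where "\<And>x. d x = of_int m" by metis
  then have "F x = G x + 2 * pi * of_int m" for x
    by (simp add: d_def field_simps)
  then show ?thesis by (rule that)
qed

text \<open>\<open>F\<close> commutes with translations by multiples of \<open>2 * pi\<close>, so
  every iteration adds the same shift.\<close>

lemma (in degree_one_mono) funpow_add_int:
  assumes "\<And>x. G x = F x + 2 * pi * of_int m"
  shows "(G ^^ n) x = (F ^^ n) x + 2 * pi * of_int m * real n"
proof (induction n)
  case (Suc n)
  have "F (y + 2 * pi) - (y + 2 * pi) = F y - y" for y by (simp add: degree)
  from periodic_of_int[of "\<lambda>y. F y - y", OF this, of "(F ^^ n) x" "m * int n"]
  have "F ((F ^^ n) x + 2 * pi * of_int m * real n) = F ((F ^^ n) x) + 2 * pi * of_int m * real n"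
    by (simp add: algebra_simps)
  then show ?case using Suc by (simp add: assms algebra_simps)
qed simp

theorem theorem2p6:
  fixes \<phi> \<eta> :: "complex \<Rightarrow> complex"
    and g :: "real \<Rightarrow> complex \<Rightarrow> complex"
    and H :: "real \<Rightarrow> complex \<Rightarrow> real"
    and F :: "real \<Rightarrow> real"
  assumes "\<phi> \<in> Symp"
    and "primitive \<eta>"
    and "symp_path g" and "\<forall>x\<in>Disk. g 0 x = x" and "\<forall>x\<in>Disk. g 1 x = \<phi> x"
    and "hamiltonian_of g H"
    and "lift_of \<phi> F"
  shows "tau_bar \<eta> \<phi> / pi\<^sup>2 + 2 * R_val H / pi\<^sup>2 - transl F \<in> \<int>"
proof -
  obtain e1 e2 where e: "C1_disk \<eta> e1 e2" "\<And>x. x \<in> ball 0 1 \<Longrightarrow> Im (e1 x) - Re (e2 x) = 1"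
    using primitive_Disk[OF assms(2)] by blast
  obtain V W1 W2 V1 V2 where iso: "isotopy_derivs g V W1 W2 V1 V2"
    using isotopy_derivs_exist[OF assms(3)] .
  interpret hamiltonian_isotopy g H V W1 W2 V1 V2 \<eta> e1 e2
    by unfold_locales (use iso e assms in \<open>auto simp: symp_path_def\<close>)
  let ?F = "\<lambda>\<theta>. lift \<theta> 1"
  interpret F: degree_one_mono ?F by (rule degree_one_lift)
  obtain C where C: "\<And>n. \<bar>tau \<eta> (\<phi> ^^ n) + 2 * real n * R_val H - pi / 2 * (?F ^^ n) 0\<bar> \<le> C"
    using tau_funpow_asymptotics[OF assms(1)] assms(5) by metis
  obtain L where L: "(\<lambda>n. (?F ^^ n) 0 / real n) \<longlonglongrightarrow> L"
    using F.transl_convergent by (auto simp: convergent_def)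
  have "(\<lambda>n. (tau \<eta> (\<phi> ^^ n) + 2 * real n * R_val H - pi / 2 * (?F ^^ n) 0) / real n) \<longlonglongrightarrow> 0"
  proof (rule Lim_null_comparison)
    \<comment> \<open>At \<open>n = 0\<close> both sides are 0, because division by zero gives
      0.\<close>
    show "\<forall>\<^sub>F n in sequentially. norm ((tau \<eta> (\<phi> ^^ n) + 2 * real n * R_val H - pi / 2 * (?F ^^ n) 0) / real n) \<le> C / real n"
      using C by (auto simp: divide_right_mono)
    show "(\<lambda>n. C / real n) \<longlonglongrightarrow> 0" by (rule lim_const_over_n)
  qed
  \<comment> \<open>The vanishing error is solved for
    \<open>tau \<eta> (\<phi> ^^ n) / real n\<close>; the rearrangement holds from
    \<open>n = 1\<close> on.\<close>
  from tendsto_add[OF tendsto_diff[OF this tendsto_const[of "2 * R_val H"]] tendsto_mult[OF tendsto_const[of "pi / 2"] L]]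
  have "(\<lambda>n. tau \<eta> (\<phi> ^^ n) / real n) \<longlonglongrightarrow> 0 - 2 * R_val H + pi / 2 * L"
    by (rule Lim_transform_eventually) (auto intro!: eventually_sequentiallyI[of 1] simp: field_simps)
  then have tau: "tau_bar \<eta> \<phi> = pi / 2 * L - 2 * R_val H"
    unfolding tau_bar_def by (simp add: limI)
  have F: "continuous_on UNIV F" "\<And>x. \<phi> (cis x) = cis (F x)"
    using assms(7) by (auto simp: lift_of_def)
  \<comment> \<open>The given lift and the one from the isotopy cover the same circle map, hence
    differ by a constant \<open>2 * pi * of_int m\<close>.\<close>
  have "cis (F x) = cis (?F x)" for x
    using F(2)[of x] assms(5) cis_lift[of 1 x] by simp
  with lifts_differ_by_int[OF F(1) cont_lift] obtain m :: int where m: "\<And>x. F x = ?F x + 2 * pi * of_int m"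
    by blast
  have "(\<lambda>n. (?F ^^ n) 0 / real n / (2 * pi) + of_int m) \<longlonglongrightarrow> L / (2 * pi) + of_int m"
    by (intro tendsto_intros L) simp
  then have "(\<lambda>n. (F ^^ n) 0 / (2 * pi * real n)) \<longlonglongrightarrow> L / (2 * pi) + of_int m"
    by (rule Lim_transform_eventually)
      (auto intro!: eventually_sequentiallyI[of 1] simp: F.funpow_add_int[OF m] field_simps)
  then have "transl F = L / (2 * pi) + of_int m"
    unfolding transl_def by (rule limI)
  \<comment> \<open>The terms in \<open>R_val H\<close> cancel, and \<open>pi / 2 * L\<close>
    divided by the square of \<open>pi\<close> cancels \<open>L / (2 * pi)\<close>; what remains is
    the integer by which the lifts differ.\<close>
  then have "tau_bar \<eta> \<phi> / pi\<^sup>2 + 2 * R_val H / pi\<^sup>2 - transl F = of_int (- m)"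
    unfolding tau by (simp add: field_simps power2_eq_square)
  then show ?thesis by simp
qed

end
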